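(* Let $n=mK$, and let $A$ be drawn from a weakly assortative balanced block model $\mathrm{BM}^{\mathrm{bal}}_m(\Psi)$ (i.e. $p_k>q^*_k$ for all $k$) with true cluster matrix $X_0=I_K\otimes E_m$. For any $c_1,c_2>0$, let $$C_1:=\max\{C',\tfrac49(c_1+1)\},\qquad C_2:=\max\{\sqrt{4(c_1+1)}+C,\; 6\sqrt{2(c_2+1)}\}.$$ Assume $\min_k\tilde p_k\ge C_1$. Then, if $$\min_k\Big[(\tilde p_k-\tilde q^{*}_k)-C_2\big(\sqrt{\tilde p_k}+\sqrt{\tilde q^{*}_k}\big)\Big]>C\sqrt{\frac{\tilde q^{*}_{\max}K}{\log n}},$$ SDP-1 is strongly consistent (i.e. $X_0$ is the unique solution of SDP-1 with input $A$) with probability at least $1-c(Km^{-r}+n^{-r})-n^{-c_1}-2m^{-1}n^{-c_2}$.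
   Context: **Model.** Let $n=mK$ and let $S_1,\dots,S_K$ be the consecutive blocks of size $m$ partitioning $[n]$. $\Psi\in[0,1]^{K\times K}$ is symmetric, $p_k:=\Psi_{kk}$, $q_{k\ell}:=\Psi_{k\ell}$ for $k\ne\ell$. $A\sim\mathrm{BM}^{\mathrm{bal}}_m(\Psi)$ means: $A$ is a symmetric $n\times n$ matrix whose entries $A_{ij}$, $i<j$, are independent Bernoulli variables with $\mathbb E A_{ij}=\Psi_{k\ell}$ for $i\in S_k,\ j\in S_\ell$. Diagonal entries of $A$ are not part of the observed data; by convention they are defined so that $\mathbb E A_{ii}=p_k$ for $i\in S_k$ (they do not affect the solution set of the SDP below because $\mathrm{diag}(X)$ is fixed). $E_m$ is the $m\times m$ all-ones matrix and $\mathbf 1_n$ the all-ones vector in $\mathbb R^n$. **Parameters.** $q^*_k:=\max_{\ell\ne k}q_{k\ell}$, $q^*_{\max}:=\max_k q^*_k$. Scaled versions: $\tilde p_k:=p_k m/\log n$, $\tilde q^*_k:=q^*_k m/\log n$, $\tilde q^*_{\max}:=q^*_{\max}m/\log n$. **SDP-1:** maximize $\langle A,X\rangle=\mathrm{tr}(AX)$ over symmetric $X\in\mathbb R^{n\times n}$ subject to $X\mathbf 1_n=(n/K)\mathbf 1_n$, $\mathrm{diag}(X)=\mathbf 1_n$, $X\succeq 0$ (positive semidefinite), $X\ge 0$ (entrywise). **Constants.** $(C,C',c,r)$ are fixed universal positive constants with the following (known) property: for every $N$ and every symmetric random matrix $B\in\{0,1\}^{N\times N}$ with independent lower-triangular entries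 and zero diagonal, if $\max_{ij}\mathrm{Var}(B_{ij})\le\sigma^2$ with $N\sigma^2\ge C'\log N$, then with probability at least $1-cN^{-r}$ one has $\|B-\mathbb E B\|\le C\sigma\sqrt N$ (operator norm). *)

theory Defs
  imports "HOL-Probability.Probability" "Jordan_Normal_Form.Matrix"
begin

definition all_ones_mat :: "nat \<Rightarrow> real mat" where
  "all_ones_mat m = mat m m (\<lambda>_. 1)"

definition all_ones_vec :: "nat \<Rightarrow> real vec" where
  "all_ones_vec n = vec n (\<lambda>_. 1)"

definition mat_trace :: "real mat \<Rightarrow> real" where
  "mat_trace A = (\<Sum>i<dim_row A. A $$ (i, i))"

definition kronecker :: "real mat \<Rightarrow> real mat \<Rightarrow> real mat" (infixl "\<otimes>\<^sub>K" 70) where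
  "A \<otimes>\<^sub>K B = mat (dim_row A * dim_row B) (dim_col A * dim_col B)
     (\<lambda>(i, j). A $$ (i div dim_row B, j div dim_col B) * B $$ (i mod dim_row B, j mod dim_col B))"

definition psd :: "nat \<Rightarrow> real mat \<Rightarrow> bool" where
  "psd n X \<longleftrightarrow> X \<in> carrier_mat n n \<and> transpose_mat X = X \<and>
     (\<forall>v \<in> carrier_vec n. 0 \<le> scalar_prod v (X *\<^sub>v v))"

definition euclidean_norm :: "real vec \<Rightarrow> real" where
  "euclidean_norm v = sqrt (scalar_prod v v)"

definition operator_norm :: "real mat \<Rightarrow> real" where
  "operator_norm B = (SUP v \<in> {v \<in> carrier_vec (dim_col B). euclidean_norm v = 1}.
     euclidean_norm (B *\<^sub>v v))"

definition expected_mat :: "'a measure \<Rightarrow> nat \<Rightarrow> ('a \<Rightarrow> real mat) \<Rightarrow> real mat" where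
  "expected_mat M n B = mat n n (\<lambda>(i, j). prob_space.expectation M (\<lambda>\<omega>. B \<omega> $$ (i, j)))"

definition random_01_symmetric :: "'a measure \<Rightarrow> nat \<Rightarrow> ('a \<Rightarrow> real mat) \<Rightarrow> bool" where
  "random_01_symmetric M N B \<longleftrightarrow>
     prob_space M \<and>
     (\<forall>\<omega> \<in> space M. B \<omega> \<in> carrier_mat N N \<and> transpose_mat (B \<omega>) = B \<omega> \<and>
        (\<forall>i<N. \<forall>j<N. B \<omega> $$ (i, j) \<in> {0, 1}) \<and> (\<forall>i<N. B \<omega> $$ (i, i) = 0)) \<and>
     prob_space.indep_vars M (\<lambda>_. borel) (\<lambda>(i, j) \<omega>. B \<omega> $$ (i, j)) {(i, j). j < i \<and> i < N}"

text \<open>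
  The property depends only on the law of the random matrix, and every such law is realised on a
  probability space whose outcomes are themselves matrices. Quantifying over the probability
  measures on \<^typ>\<open>real mat\<close> (with any sigma-algebra) therefore covers all random matrices, and the
  constants do not depend on the sample space of a particular model.
\<close>
definition concentration_constants :: "real \<Rightarrow> real \<Rightarrow> real \<Rightarrow> real \<Rightarrow> bool" where
  "concentration_constants C C' c r \<longleftrightarrow>
     C > 0 \<and> C' > 0 \<and> c > 0 \<and> r > 0 \<and>
     (\<forall>N (M :: real mat measure) (B :: real mat \<Rightarrow> real mat) \<sigma>.
        N \<ge> 1 \<and> random_01_symmetric M N B \<and> \<sigma> \<ge> 0 \<and>
        (\<forall>i<N. \<forall>j<N. prob_space.variance M (\<lambda>\<omega>. B \<omega> $$ (i, j)) \<le> \<sigma>\<^sup>2) \<and>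
        real N * \<sigma>\<^sup>2 \<ge> C' * ln (real N)
        \<longrightarrow> prob_space.prob M
              {\<omega> \<in> space M. operator_norm (B \<omega> - expected_mat M N B) \<le> C * \<sigma> * sqrt (real N)}
            \<ge> 1 - c * real N powr (- r))"

definition connectivity_mat :: "nat \<Rightarrow> real mat \<Rightarrow> bool" where
  "connectivity_mat K \<Psi> \<longleftrightarrow> \<Psi> \<in> carrier_mat K K \<and> transpose_mat \<Psi> = \<Psi> \<and>
     (\<forall>k<K. \<forall>l<K. 0 \<le> \<Psi> $$ (k, l) \<and> \<Psi> $$ (k, l) \<le> 1)"

text \<open>
  Indices start at 0, so the block of index \<open>i\<close> is \<open>i div m\<close>. The diagonal entries of \<open>A\<close> are
  constrained only through their means; they need not be independent or take values in \<open>{0, 1}\<close>.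
\<close>
definition BM_bal :: "'a measure \<Rightarrow> nat \<Rightarrow> nat \<Rightarrow> real mat \<Rightarrow> ('a \<Rightarrow> real mat) \<Rightarrow> bool" where
  "BM_bal M m K \<Psi> A \<longleftrightarrow>
     prob_space M \<and> connectivity_mat K \<Psi> \<and>
     (\<forall>\<omega> \<in> space M. A \<omega> \<in> carrier_mat (m * K) (m * K) \<and> transpose_mat (A \<omega>) = A \<omega> \<and>
        (\<forall>i<m * K. \<forall>j<m * K. i \<noteq> j \<longrightarrow> A \<omega> $$ (i, j) \<in> {0, 1})) \<and>
     prob_space.indep_vars M (\<lambda>_. borel) (\<lambda>(i, j) \<omega>. A \<omega> $$ (i, j)) {(i, j). i < j \<and> j < m * K} \<and>
     (\<forall>i<m * K. \<forall>j<m * K. i \<noteq> j \<longrightarrow>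
        prob_space.expectation M (\<lambda>\<omega>. A \<omega> $$ (i, j)) = \<Psi> $$ (i div m, j div m)) \<and>
     (\<forall>i<m * K. integrable M (\<lambda>\<omega>. A \<omega> $$ (i, i)) \<and>
        prob_space.expectation M (\<lambda>\<omega>. A \<omega> $$ (i, i)) = \<Psi> $$ (i div m, i div m))"

definition p_in :: "real mat \<Rightarrow> nat \<Rightarrow> real" where
  "p_in \<Psi> k = \<Psi> $$ (k, k)"

text \<open>The maxima below are over nonempty sets only if the number of blocks is at least 2.\<close>
definition q_star :: "real mat \<Rightarrow> nat \<Rightarrow> real" where
  "q_star \<Psi> k = (MAX l \<in> {..<dim_row \<Psi>} - {k}. \<Psi> $$ (k, l))"

definition q_star_max :: "real mat \<Rightarrow> real" where
  "q_star_max \<Psi> = (MAX k \<in> {..<dim_row \<Psi>}. q_star \<Psi> k)"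

definition weakly_assortative :: "real mat \<Rightarrow> bool" where
  "weakly_assortative \<Psi> \<longleftrightarrow> (\<forall>k<dim_row \<Psi>. p_in \<Psi> k > q_star \<Psi> k)"

definition scaled :: "nat \<Rightarrow> nat \<Rightarrow> real \<Rightarrow> real" where
  "scaled m n x = x * real m / ln (real n)"

definition sdp1_feasible :: "nat \<Rightarrow> nat \<Rightarrow> real mat set" where
  "sdp1_feasible n K = {X \<in> carrier_mat n n. transpose_mat X = X \<and>
     X *\<^sub>v all_ones_vec n = (real n / real K) \<cdot>\<^sub>v all_ones_vec n \<and>
     (\<forall>i<n. X $$ (i, i) = 1) \<and>
     psd n X \<and>
     (\<forall>i<n. \<forall>j<n. 0 \<le> X $$ (i, j))}"

definition sdp1_solutions :: "nat \<Rightarrow> nat \<Rightarrow> real mat \<Rightarrow> real mat set" where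
  "sdp1_solutions n K A = {X \<in> sdp1_feasible n K.
     \<forall>Y \<in> sdp1_feasible n K. mat_trace (A * Y) \<le> mat_trace (A * X)}"

definition true_cluster_mat :: "nat \<Rightarrow> nat \<Rightarrow> real mat" where
  "true_cluster_mat m K = 1\<^sub>m K \<otimes>\<^sub>K all_ones_mat m"

end

theory Submission
  imports Defs
begin

text \<open>
  Write \<open>d\<^sub>i(l)\<close> for the degree of \<open>i\<close> into block \<open>l\<close> and \<open>e\<^sub>k\<^sub>l\<close> for the total weight between two
  blocks. With block constants \<open>\<mu>\<^sub>k\<close>, the multiplier of \<open>X \<ge> 0\<close> is
  \<open>\<Gamma>\<^sub>i\<^sub>j = \<mu>\<^sub>k + \<mu>\<^sub>l - d\<^sub>i(l) / m - d\<^sub>j(k) / m + e\<^sub>k\<^sub>l / m\<^sup>2\<close> for \<open>i\<close>, \<open>j\<close> in different blocks \<open>k\<close>, \<open>l\<close>.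
  The dual matrix then annihilates the indicators of the blocks, and on vectors with vanishing block
  sums it acts as \<open>diag (d\<^sub>i(k) - 2 m \<mu>\<^sub>k) - A\<close>, where the mean of \<open>A\<close> contributes only \<open>- p\<^sub>k\<close>.
  Positivity there follows from the norm bounds, applied to each diagonal block and to the
  off-diagonal part separately, and from lower tails of the inner degrees. Choosing \<open>\<mu>\<^sub>k\<close> as large as
  this permits makes \<open>\<Gamma>\<close> strictly positive by upper tails of the outer degrees, and strict positivity
  forces every optimal \<open>X\<close> to vanish off the blocks, hence to equal \<open>X\<^sub>0\<close>.

  The gap condition also implies \<open>p\<^sub>k m \<ge> C\<^sub>2\<^sup>2 log n\<close>, so \<open>log n \<ge> 6\<close>. The resulting slack between
  \<open>sqrt (p\<^sub>k m)\<close> and \<open>sqrt (p\<^sub>k m log n)\<close> pays for the fluctuations of the outer degrees and for the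
  regime in which \<open>q\<^sub>m\<^sub>a\<^sub>x\<close> is too small for the norm bound to apply at its own variance.
\<close>

section \<open>Optimality certificate\<close>

text \<open>Kernels are plain functions on an arbitrary index set, so that an induction can split
  off one index at a time.\<close>

definition quad_form :: "'i set \<Rightarrow> ('i \<Rightarrow> 'i \<Rightarrow> real) \<Rightarrow> ('i \<Rightarrow> real) \<Rightarrow> real" where
  "quad_form I x v = (\<Sum>i\<in>I. \<Sum>j\<in>I. x i j * v i * v j)"

lemma quad_form_insert:
  assumes "finite I" "k \<notin> I"
  shows "quad_form (insert k I) x v =
    x k k * (v k)\<^sup>2 + v k * (\<Sum>i\<in>I. (x i k + x k i) * v i) + quad_form I x v"
  using assms by (simp add: quad_form_def sum.distrib sum_distrib_left algebra_simps power2_eq_square)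

lemma quad_form_cong:
  assumes "\<And>i. i \<in> I \<Longrightarrow> v i = w i"
  shows "quad_form I x v = quad_form I x w"
  using assms by (simp add: quad_form_def)

text \<open>Along the vectors t e_k + e_i the form is affine in t with slope 2 x i k, and an affine
  function that is bounded below has slope 0.\<close>

lemma psd_zero_diagonal:
  assumes "finite I" "k \<notin> I" "i \<in> I" and sym: "x k i = x i k"
    and psd: "\<And>v. 0 \<le> quad_form (insert k I) x v" and "x k k = 0"
  shows "x i k = 0"
proof (rule ccontr)
  assume nz: "x i k \<noteq> 0"
  define v where "v t j = (if j = k then t else if j = i then 1 else 0)" for t :: real and j
  have "quad_form I x (v t) = x i i" for t
    using assms(1,2,3) by (auto simp: quad_form_def v_def sum.If_cases if_distrib[of "\<lambda>z. _ * z"]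
        sum.delta' cong: if_cong intro!: trans[OF sum.mono_neutral_cong_right[of I "{i}"]])
  moreover have "(\<Sum>j\<in>I. (x j k + x k j) * v t j) = 2 * x i k" for t
    using assms(1,2,3) sym
    by (subst sum.mono_neutral_cong_right[of I "{i}" _ "\<lambda>j. 2 * x i k"]) (auto simp: v_def)
  ultimately have "0 \<le> t * (2 * x i k) + x i i" for t
    using psd[of "v t"] assms(1,2,6) by (simp add: quad_form_insert v_def)
  \<comment> \<open>This t makes the affine function equal to -1.\<close>
  from this[of "- (x i i + 1) / (2 * x i k)"] nz show False by simp
qed

text \<open>Self-duality of the positive semidefinite cone, without a spectral decomposition:
  splitting off the index k writes x as a rank-one term plus a Schur complement. The rank-one term
  contributes a multiple of a value of the form of y, and the induction hypothesis handles the
  complement.\<close>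

lemma psd_inner_nonneg:
  assumes "finite I" and "\<And>i j. i \<in> I \<Longrightarrow> j \<in> I \<Longrightarrow> x i j = x j i"
    and "\<And>v. 0 \<le> quad_form I x v" and "\<And>v. 0 \<le> quad_form I y v"
  shows "0 \<le> (\<Sum>i\<in>I. \<Sum>j\<in>I. x i j * y i j)"
  using assms
proof (induction I arbitrary: x rule: finite_induct)
  case empty
  then show ?case by simp
next
  case (insert k I)
  define z where "z = x k k"
  \<comment> \<open>The Schur complement of the pivot z. For z = 0 the quotient is 0 by convention,
    so x' is then x.\<close>
  define x' where "x' i j = x i j - x i k * x j k / z" for i j
  have sym: "x i k = x k i" if "i \<in> I" for i using insert.prems(1) that by auto
  have x': "quad_form I x' v = quad_form I x v - (\<Sum>i\<in>I. x i k * v i)\<^sup>2 / z" for v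
    by (simp add: quad_form_def x'_def algebra_simps sum_subtractf sum_divide_distrib
        power2_eq_square sum_product)
  have z0: "z \<ge> 0"
    using insert.prems(2)[of "\<lambda>i. if i = k then 1 else 0"] insert.hyps
    by (simp add: quad_form_insert z_def quad_form_def sum.neutral)
  have zero: "x i k = 0" if "z = 0" "i \<in> I" for i
    using psd_zero_diagonal[of I k i x] insert.hyps insert.prems(2) that sym[of i] z_def by auto
  have psd': "0 \<le> quad_form I x' v" for v
  proof (cases "z = 0")
    case True
    have "quad_form (insert k I) x (v(k := 0)) = quad_form I x v"
      using insert.hyps by (subst quad_form_insert) (auto intro!: quad_form_cong)
    then have "0 \<le> quad_form I x v" using insert.prems(2)[of "v(k := 0)"] by argo
    then show ?thesis using True x'[of v] by simp
  next
    case False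
    \<comment> \<open>The coordinate - s / z at k minimises the form of x when the other coordinates
      are held fixed; the minimum is the form of the Schur complement.\<close>
    define s where "s = (\<Sum>i\<in>I. x i k * v i)"
    have 1: "(\<Sum>i\<in>I. (x i k + x k i) * (v(k := - s / z)) i) = 2 * s"
      using insert.hyps unfolding s_def sum_distrib_left by (intro sum.cong) (auto simp: sym)
    have 2: "quad_form I x (v(k := - s / z)) = quad_form I x v"
      using insert.hyps by (auto intro!: quad_form_cong)
    have "quad_form (insert k I) x (v(k := - s / z)) = quad_form I x v - s\<^sup>2 / z"
      unfolding quad_form_insert[OF insert.hyps] 1 2
      using False by (simp add: z_def[symmetric] field_simps power2_eq_square)
    then have "0 \<le> quad_form I x v - s\<^sup>2 / z" using insert.prems(2)[of "v(k := - s / z)"] by argo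
    then show ?thesis using x'[of v] s_def by simp
  qed
  have y': "0 \<le> quad_form I y v" for v
  proof -
    have "quad_form (insert k I) y (v(k := 0)) = quad_form I y v"
      using insert.hyps by (subst quad_form_insert) (auto intro!: quad_form_cong)
    then show ?thesis using insert.prems(3)[of "v(k := 0)"] by argo
  qed
  have IH: "0 \<le> (\<Sum>i\<in>I. \<Sum>j\<in>I. x' i j * y i j)"
    by (rule insert.IH[OF _ psd' y']) (simp add: x'_def insert.prems(1) mult.commute)
  have split: "(\<Sum>i\<in>insert k I. \<Sum>j\<in>insert k I. x i j * y i j)
      = z * y k k + (\<Sum>i\<in>I. x i k * (y i k + y k i)) + (\<Sum>i\<in>I. \<Sum>j\<in>I. x i j * y i j)"
    using insert.hyps by (simp add: z_def sum.distrib algebra_simps sym)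
  show ?case
  proof (cases "z = 0")
    case True
    then show ?thesis using IH zero unfolding split by (simp add: x'_def)
  next
    case False
    define w where "w i = x i k" for i
    \<comment> \<open>Multiplying by z clears the denominator. Since w k = z, the rank-one direction
      on the whole of \<open>insert k I\<close> is the column w.\<close>
    have "z * (\<Sum>i\<in>I. \<Sum>j\<in>I. x i j * y i j) =
        z * (\<Sum>i\<in>I. \<Sum>j\<in>I. x' i j * y i j) + quad_form I y w"
      using False
      by (simp add: x'_def w_def quad_form_def algebra_simps sum_subtractf sum_distrib_left)
    then have "z * (\<Sum>i\<in>insert k I. \<Sum>j\<in>insert k I. x i j * y i j) =
        quad_form (insert k I) y w + z * (\<Sum>i\<in>I. \<Sum>j\<in>I. x' i j * y i j)"
      unfolding split quad_form_insert[OF insert.hyps]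
      by (simp add: w_def z_def distrib_left power2_eq_square sum_distrib_left algebra_simps)
    then have "0 \<le> z * (\<Sum>i\<in>insert k I. \<Sum>j\<in>insert k I. x i j * y i j)"
      using insert.prems(3)[of w] IH z0 by simp
    then show ?thesis using False z0 by (simp add: zero_le_mult_iff)
  qed
qed

text \<open>Evaluate the form at e_i - e_j.\<close>

lemma psd_entry_le_1:
  assumes "finite I" "i \<in> I" "j \<in> I" "x i j = x j i"
    and psd: "\<And>v. 0 \<le> quad_form I x v" and "x i i = 1" "x j j = 1"
  shows "x i j \<le> 1"
proof (cases "i = j")
  case False
  define v where "v l = (if l = i then 1 else if l = j then -1 else 0 :: real)" for l
  have "quad_form I x v = (\<Sum>a\<in>{i,j}. \<Sum>b\<in>{i,j}. x a b * v a * v b)"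
    unfolding quad_form_def using assms(1,2,3)
    by (intro sum.mono_neutral_cong_right) (auto simp: v_def intro!: sum.mono_neutral_right sum.neutral)
  also have "\<dots> = 2 - 2 * x i j"
    using False assms by (simp add: v_def)
  finally show ?thesis using psd[of v] by simp
qed (use assms in simp)

section \<open>Dual variables for a partition into blocks\<close>

lemma sum_over_labels:
  fixes f :: "'i \<Rightarrow> real"
  assumes "finite I"
  shows "(\<Sum>i\<in>I. f i) = (\<Sum>l\<in>b ` I. \<Sum>i | i \<in> I \<and> b i = l. f i)"
  using sum.group[of I "b ` I" b f] assms by simp

definition block_degree :: "'i set \<Rightarrow> ('i \<Rightarrow> 'k) \<Rightarrow> ('i \<Rightarrow> 'i \<Rightarrow> real) \<Rightarrow> 'i \<Rightarrow> 'k \<Rightarrow> real" where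
  "block_degree I b a i l = (\<Sum>j | j \<in> I \<and> b j = l. a i j)"

definition block_total :: "'i set \<Rightarrow> ('i \<Rightarrow> 'k) \<Rightarrow> ('i \<Rightarrow> 'i \<Rightarrow> real) \<Rightarrow> 'k \<Rightarrow> 'k \<Rightarrow> real" where
  "block_total I b a k l = (\<Sum>i | i \<in> I \<and> b i = k. block_degree I b a i l)"

text \<open>
  The slack is chosen so that each off-diagonal block of \<open>dual_psd\<close> is minus the doubly centred
  block of \<open>a\<close>, whose row sums vanish.
\<close>
definition dual_slack :: "'i set \<Rightarrow> ('i \<Rightarrow> 'k) \<Rightarrow> ('i \<Rightarrow> 'i \<Rightarrow> real) \<Rightarrow> real \<Rightarrow> ('k \<Rightarrow> real) \<Rightarrow> 'i \<Rightarrow> 'i \<Rightarrow> real" where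
  "dual_slack I b a m \<mu> i j = (if b i = b j then 0 else
     \<mu> (b i) + \<mu> (b j) - block_degree I b a i (b j) / m - block_degree I b a j (b i) / m
       + block_total I b a (b i) (b j) / m\<^sup>2)"

text \<open>The multiplier of the semidefinite constraint. The diagonal entries stem from the
  constraint on diag(X) and the terms \<mu> from the row sums; the diagonal is the one for which the
  row sums inside each block vanish.\<close>

definition dual_psd :: "'i set \<Rightarrow> ('i \<Rightarrow> 'k) \<Rightarrow> ('i \<Rightarrow> 'i \<Rightarrow> real) \<Rightarrow> real \<Rightarrow> ('k \<Rightarrow> real) \<Rightarrow> 'i \<Rightarrow> 'i \<Rightarrow> real" where
  "dual_psd I b a m \<mu> i j =
     (if i = j then block_degree I b a i (b i) - 2 * m * \<mu> (b i) else 0)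
       + \<mu> (b i) + \<mu> (b j) - a i j - dual_slack I b a m \<mu> i j"

text \<open>Positivity of the dual matrix is asked for only on vectors with vanishing block sums,
  because the block indicators lie in its kernel. The strict sign of the slack is what yields
  uniqueness.\<close>

locale block_certificate =
  fixes I :: "'i set" and b :: "'i \<Rightarrow> 'k" and a :: "'i \<Rightarrow> 'i \<Rightarrow> real" and m :: real and \<mu> :: "'k \<Rightarrow> real"
  assumes fin: "finite I"
    and card_block: "\<And>i. i \<in> I \<Longrightarrow> real (card {j \<in> I. b j = b i}) = m"
    and a_sym: "\<And>i j. i \<in> I \<Longrightarrow> j \<in> I \<Longrightarrow> a i j = a j i"
    and slack_pos: "\<And>i j. i \<in> I \<Longrightarrow> j \<in> I \<Longrightarrow> b i \<noteq> b j \<Longrightarrow> 0 < dual_slack I b a m \<mu> i j"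
    and balanced: "\<And>u. (\<And>l. (\<Sum>i | i \<in> I \<and> b i = l. u i) = 0) \<Longrightarrow>
       quad_form I a u \<le> (\<Sum>i\<in>I. (block_degree I b a i (b i) - 2 * m * \<mu> (b i)) * (u i)\<^sup>2)"
begin

lemma m_pos: "i \<in> I \<Longrightarrow> 0 < m"
  using card_block[of i] fin by (metis (mono_tags, lifting) card_gt_0_iff empty_iff mem_Collect_eq of_nat_0_less_iff finite_subset subsetI)

lemma total_sym: "block_total I b a k l = block_total I b a l k"
  unfolding block_total_def block_degree_def
  by (subst sum.swap) (auto intro!: sum.cong a_sym)

lemma dual_psd_sym: "i \<in> I \<Longrightarrow> j \<in> I \<Longrightarrow> dual_psd I b a m \<mu> i j = dual_psd I b a m \<mu> j i"
  using a_sym[of i j] total_sym[of "b i" "b j"] by (auto simp: dual_psd_def dual_slack_def)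

text \<open>Inside a block the diagonal entry cancels the rest of the row; between blocks the double
  centring does.\<close>

lemma dual_psd_row:
  assumes i: "i \<in> I" and l: "l \<in> b ` I"
  shows "(\<Sum>j | j \<in> I \<and> b j = l. dual_psd I b a m \<mu> i j) = 0"
proof -
  note m = m_pos[OF i]
  have card: "real (card {j \<in> I. b j = l}) = m" using l card_block by auto
  show ?thesis
  proof (cases "l = b i")
    case True
    have "(\<Sum>j | j \<in> I \<and> b j = l. dual_psd I b a m \<mu> i j) =
      (\<Sum>j | j \<in> I \<and> b j = l. (if i = j then block_degree I b a i (b i) - 2 * m * \<mu> (b i) else 0)
         + 2 * \<mu> (b i) - a i j)"
      using True by (intro sum.cong) (auto simp: dual_psd_def dual_slack_def)
    also have "\<dots> = block_degree I b a i (b i) - 2 * m * \<mu> (b i) + m * (2 * \<mu> (b i)) - block_degree I b a i l"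
      using i True fin card by (simp add: sum.distrib sum_subtractf block_degree_def)
    finally show ?thesis using True by simp
  next
    case False
    have "(\<Sum>j | j \<in> I \<and> b j = l. dual_psd I b a m \<mu> i j) =
      (\<Sum>j | j \<in> I \<and> b j = l. block_degree I b a i l / m + block_degree I b a j (b i) / m
         - block_total I b a l (b i) / m\<^sup>2 - a i j)"
      using False total_sym[of l "b i"] by (intro sum.cong) (auto simp: dual_psd_def dual_slack_def)
    also have "\<dots> = m * (block_degree I b a i l / m) + block_total I b a l (b i) / m
         - m * (block_total I b a l (b i) / m\<^sup>2) - block_degree I b a i l"
      using card by (simp add: sum.distrib sum_subtractf block_total_def sum_divide_distrib[symmetric])
        (simp add: block_degree_def)
    also have "\<dots> = 0" using m by (simp add: power2_eq_square)
    finally show ?thesis .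
  qed
qed

lemma dual_psd_row_const:
  assumes i: "i \<in> I"
  shows "(\<Sum>j\<in>I. dual_psd I b a m \<mu> i j * w (b j)) = 0"
proof -
  have "(\<Sum>j\<in>I. dual_psd I b a m \<mu> i j * w (b j)) =
     (\<Sum>l\<in>b ` I. \<Sum>j | j \<in> I \<and> b j = l. dual_psd I b a m \<mu> i j * w l)"
    by (subst sum_over_labels[OF fin, of _ b]) (auto intro!: sum.cong)
  also have "\<dots> = (\<Sum>l\<in>b ` I. (\<Sum>j | j \<in> I \<and> b j = l. dual_psd I b a m \<mu> i j) * w l)"
    by (simp add: sum_distrib_right)
  also have "\<dots> = 0" using dual_psd_row[OF i] by simp
  finally show ?thesis .
qed

lemma sum_mult_label_zero:
  fixes u :: "'i \<Rightarrow> real"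
  assumes "\<And>l. (\<Sum>i | i \<in> I \<and> b i = l. u i) = 0"
  shows "(\<Sum>i\<in>I. w (b i) * u i) = 0"
proof -
  have "(\<Sum>i\<in>I. w (b i) * u i) = (\<Sum>l\<in>b ` I. \<Sum>i | i \<in> I \<and> b i = l. w l * u i)"
    by (subst sum_over_labels[OF fin, of _ b]) (auto intro!: sum.cong)
  then show ?thesis using assms by (simp add: sum_distrib_left[symmetric])
qed

text \<open>Apart from the diagonal and \<open>a\<close>, every term depends on i or on j only
  through its block, so it vanishes against a vector with zero block sums.\<close>

lemma quad_form_dual_psd_balanced:
  assumes u: "\<And>l. (\<Sum>i | i \<in> I \<and> b i = l. u i) = 0"
  shows "quad_form I (dual_psd I b a m \<mu>) u =
    (\<Sum>i\<in>I. (block_degree I b a i (b i) - 2 * m * \<mu> (b i)) * (u i)\<^sup>2) - quad_form I a u"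
proof -
  define \<nu> where "\<nu> i = block_degree I b a i (b i) - 2 * m * \<mu> (b i)" for i
  \<comment> \<open>g collects the terms that see i only through its block, h those that see j only
    through its block. Within one block both \<mu> terms are put into g.\<close>
  define g where "g k j = (if k = b j then 2 * \<mu> k else
     block_degree I b a j k / m - block_total I b a k (b j) / m\<^sup>2)" for k j
  define h where "h i l = (if b i = l then 0 else block_degree I b a i l / m)" for i l
  have eq: "dual_psd I b a m \<mu> i j = (if i = j then \<nu> i else 0) - a i j + g (b i) j + h i (b j)"
    for i j
    by (auto simp: dual_psd_def dual_slack_def \<nu>_def g_def h_def)
  have "quad_form I (dual_psd I b a m \<mu>) u = (\<Sum>i\<in>I. \<Sum>j\<in>I. (if i = j then \<nu> i * u i * u j else 0))
     - quad_form I a u + (\<Sum>i\<in>I. \<Sum>j\<in>I. g (b i) j * u i * u j) + (\<Sum>i\<in>I. \<Sum>j\<in>I. h i (b j) * u i * u j)"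
    unfolding quad_form_def eq sum.distrib[symmetric] sum_subtractf[symmetric]
    by (intro sum.cong refl) (auto simp: algebra_simps)
  also have "(\<Sum>i\<in>I. \<Sum>j\<in>I. (if i = j then \<nu> i * u i * u j else 0)) = (\<Sum>i\<in>I. \<nu> i * (u i)\<^sup>2)"
    using fin by (simp add: power2_eq_square mult.assoc)
  also have "(\<Sum>i\<in>I. \<Sum>j\<in>I. h i (b j) * u i * u j) = (\<Sum>i\<in>I. u i * (\<Sum>j\<in>I. h i (b j) * u j))"
    by (simp add: sum_distrib_left mult_ac)
  also have "\<dots> = 0" using sum_mult_label_zero[OF u] by simp
  also have "(\<Sum>i\<in>I. \<Sum>j\<in>I. g (b i) j * u i * u j) = (\<Sum>j\<in>I. u j * (\<Sum>i\<in>I. g (b i) j * u i))"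
    by (subst sum.swap) (simp add: sum_distrib_left mult_ac)
  also have "\<dots> = 0"
  proof (intro sum.neutral ballI)
    fix j
    show "u j * (\<Sum>i\<in>I. g (b i) j * u i) = 0"
      using sum_mult_label_zero[OF u, of "\<lambda>k. g k j"] by simp
  qed
  finally show ?thesis by (simp add: \<nu>_def)
qed

text \<open>Subtracting the block means changes v by an element of the kernel; symmetry allows this
  on both sides of the form.\<close>

lemma dual_psd_psd: "0 \<le> quad_form I (dual_psd I b a m \<mu>) v"
proof -
  define w where "w l = (\<Sum>i | i \<in> I \<and> b i = l. v i) / m" for l
  define u where "u i = v i - w (b i)" for i
  have u0: "(\<Sum>i | i \<in> I \<and> b i = l. u i) = 0" for l
  proof (cases "l \<in> b ` I")
    case True
    then obtain i where i: "i \<in> I" "b i = l" by auto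
    have "(\<Sum>i | i \<in> I \<and> b i = l. u i) = (\<Sum>i | i \<in> I \<and> b i = l. v i) - (\<Sum>i | i \<in> I \<and> b i = l. w l)"
      by (simp add: u_def sum_subtractf)
    then show ?thesis using card_block[OF i(1)] m_pos[OF i(1)] i(2) by (simp add: w_def)
  next
    case False
    then have "{i \<in> I. b i = l} = {}" by auto
    then show ?thesis by (simp only: sum.empty)
  qed
  let ?\<Lambda> = "dual_psd I b a m \<mu>"
  have "quad_form I ?\<Lambda> v = (\<Sum>i\<in>I. v i * (\<Sum>j\<in>I. ?\<Lambda> i j * u j)) + (\<Sum>i\<in>I. v i * (\<Sum>j\<in>I. ?\<Lambda> i j * w (b j)))"
    unfolding quad_form_def u_def
    by (simp add: sum_distrib_left sum.distrib[symmetric] algebra_simps)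
  also have "\<dots> = (\<Sum>i\<in>I. v i * (\<Sum>j\<in>I. ?\<Lambda> i j * u j))"
    using dual_psd_row_const by simp
  also have "\<dots> = (\<Sum>j\<in>I. u j * (\<Sum>i\<in>I. ?\<Lambda> j i * v i))"
    unfolding sum_distrib_left
    by (subst sum.swap) (auto intro!: sum.cong simp: dual_psd_sym)
  also have "\<dots> = quad_form I ?\<Lambda> u + (\<Sum>j\<in>I. u j * (\<Sum>i\<in>I. ?\<Lambda> j i * w (b i)))"
    unfolding quad_form_def u_def
    by (simp add: sum_distrib_left sum.distrib[symmetric] algebra_simps)
  also have "\<dots> = quad_form I ?\<Lambda> u"
    using dual_psd_row_const by simp
  finally show ?thesis
    using quad_form_dual_psd_balanced[OF u0] balanced[OF u0] by simp
qed

end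

section \<open>Weak duality and uniqueness of the optimum\<close>

locale block_certificate_primal = block_certificate +
  fixes x :: "'i \<Rightarrow> 'i \<Rightarrow> real"
  assumes x_sym: "\<And>i j. i \<in> I \<Longrightarrow> j \<in> I \<Longrightarrow> x i j = x j i"
    and x_psd: "\<And>v. 0 \<le> quad_form I x v"
    and x_nonneg: "\<And>i j. i \<in> I \<Longrightarrow> j \<in> I \<Longrightarrow> 0 \<le> x i j"
    and x_diag: "\<And>i. i \<in> I \<Longrightarrow> x i i = 1"
    and x_row: "\<And>i. i \<in> I \<Longrightarrow> (\<Sum>j\<in>I. x i j) = m"
begin

text \<open>The row sums m of x turn each of the two \<mu> terms into m times the sum of the \<mu>
  (b i). Together they cancel the part - 2 m \<mu> of the diagonal, which meets x only in its
  entries 1.\<close>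

lemma inner_dual_psd:
  "(\<Sum>i\<in>I. \<Sum>j\<in>I. x i j * dual_psd I b a m \<mu> i j) =
     (\<Sum>i\<in>I. block_degree I b a i (b i)) - (\<Sum>i\<in>I. \<Sum>j\<in>I. a i j * x i j)
     - (\<Sum>i\<in>I. \<Sum>j\<in>I. dual_slack I b a m \<mu> i j * x i j)"
proof -
  have "(\<Sum>i\<in>I. \<Sum>j\<in>I. x i j * dual_psd I b a m \<mu> i j) =
     (\<Sum>i\<in>I. \<Sum>j\<in>I. if i = j then x i j * (block_degree I b a i (b i) - 2 * m * \<mu> (b i)) else 0)
     + (\<Sum>i\<in>I. \<Sum>j\<in>I. \<mu> (b i) * x i j) + (\<Sum>i\<in>I. \<Sum>j\<in>I. \<mu> (b j) * x i j)
     - (\<Sum>i\<in>I. \<Sum>j\<in>I. a i j * x i j) - (\<Sum>i\<in>I. \<Sum>j\<in>I. dual_slack I b a m \<mu> i j * x i j)"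
    unfolding sum.distrib[symmetric] sum_subtractf[symmetric]
    by (intro sum.cong refl) (auto simp: dual_psd_def algebra_simps)
  also have "(\<Sum>i\<in>I. \<Sum>j\<in>I. if i = j then x i j * (block_degree I b a i (b i) - 2 * m * \<mu> (b i)) else 0)
     = (\<Sum>i\<in>I. block_degree I b a i (b i)) - 2 * m * (\<Sum>i\<in>I. \<mu> (b i))"
    using fin x_diag by (simp add: sum_subtractf sum_distrib_left)
  also have "(\<Sum>i\<in>I. \<Sum>j\<in>I. \<mu> (b i) * x i j) = m * (\<Sum>i\<in>I. \<mu> (b i))"
    by (simp add: sum_distrib_left[symmetric] x_row sum_distrib_right[symmetric])
  also have "(\<Sum>i\<in>I. \<Sum>j\<in>I. \<mu> (b j) * x i j) = (\<Sum>j\<in>I. \<Sum>i\<in>I. \<mu> (b j) * x j i)"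
    by (subst sum.swap) (auto intro!: sum.cong simp: x_sym)
  also have "\<dots> = m * (\<Sum>i\<in>I. \<mu> (b i))"
    by (simp add: sum_distrib_left[symmetric] x_row sum_distrib_right[symmetric])
  finally show ?thesis by simp
qed

text \<open>Weak duality: the inner product of x with the dual matrix is nonnegative. The first sum
  on the right is the objective value of the block matrix.\<close>

lemma inner_a_bound:
  "(\<Sum>i\<in>I. \<Sum>j\<in>I. a i j * x i j) \<le>
     (\<Sum>i\<in>I. block_degree I b a i (b i)) - (\<Sum>i\<in>I. \<Sum>j\<in>I. dual_slack I b a m \<mu> i j * x i j)"
  using psd_inner_nonneg[OF fin x_sym x_psd dual_psd_psd] inner_dual_psd by simp

lemma slack_term_nonneg: "i \<in> I \<Longrightarrow> j \<in> I \<Longrightarrow> 0 \<le> dual_slack I b a m \<mu> i j * x i j"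
  using slack_pos[of i j] x_nonneg[of i j] by (cases "b i = b j") (auto simp: dual_slack_def)

lemma inner_a_le: "(\<Sum>i\<in>I. \<Sum>j\<in>I. a i j * x i j) \<le> (\<Sum>i\<in>I. block_degree I b a i (b i))"
proof -
  have "0 \<le> (\<Sum>i\<in>I. \<Sum>j\<in>I. dual_slack I b a m \<mu> i j * x i j)"
    by (intro sum_nonneg slack_term_nonneg)
  then show ?thesis using inner_a_bound by linarith
qed

text \<open>At the optimal value every product of slack and entry is 0, so x vanishes between
  blocks. A row then has sum m over the m entries of its own block, each at most 1, hence all equal
  to 1.\<close>

lemma optimal_unique:
  assumes opt: "(\<Sum>i\<in>I. block_degree I b a i (b i)) \<le> (\<Sum>i\<in>I. \<Sum>j\<in>I. a i j * x i j)"
    and i: "i \<in> I" and j: "j \<in> I"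
  shows "x i j = of_bool (b i = b j)"
proof -
  have "(\<Sum>i\<in>I. \<Sum>j\<in>I. dual_slack I b a m \<mu> i j * x i j) \<le> 0" using opt inner_a_bound by linarith
  then have "(\<Sum>i\<in>I. \<Sum>j\<in>I. dual_slack I b a m \<mu> i j * x i j) = 0"
    by (intro antisym sum_nonneg slack_term_nonneg)
  then have z: "dual_slack I b a m \<mu> i' j' * x i' j' = 0" if "i' \<in> I" "j' \<in> I" for i' j'
    using that fin slack_term_nonneg by (simp add: sum_nonneg_eq_0_iff sum_nonneg)
  have off: "x i j' = 0" if "j' \<in> I" "b i \<noteq> b j'" for j'
    using z[OF i that(1)] slack_pos[OF i that] by simp
  have blk: "b j' = b i" if "j' \<in> I" "x i j' \<noteq> 0" for j'
    using off[OF that(1)] that(2) by argo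
  have le1: "x i j' \<le> 1" if "j' \<in> I" for j'
    using psd_entry_le_1[OF fin i that x_sym[OF i that] x_psd] x_diag i that by simp
  have "(\<Sum>j | j \<in> I \<and> b j = b i. 1 - x i j) = 0"
  proof -
    have "(\<Sum>j | j \<in> I \<and> b j = b i. x i j) = (\<Sum>j\<in>I. x i j)"
      using blk fin by (intro sum.mono_neutral_left) auto
    then show ?thesis using card_block[OF i] x_row[OF i] by (simp add: sum_subtractf)
  qed
  then have on: "x i j' = 1" if "j' \<in> I" "b j' = b i" for j'
    using that fin le1 by (subst (asm) sum_nonneg_eq_0_iff) auto
  show ?thesis using on[OF j] off[OF j] by auto
qed

end

section \<open>Tails of Bernoulli sums\<close>

context prob_space begin

text \<open>On {0, 1} the exponential is affine in X, so the moment generating function is 1 + q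
  (exp s - 1), which is at most that of a Poisson variable.\<close>

lemma bernoulli_mgf_le:
  fixes X :: "'a \<Rightarrow> real"
  assumes rv: "random_variable borel X" and 01: "\<And>\<omega>. \<omega> \<in> space M \<Longrightarrow> X \<omega> \<in> {0, 1}"
    and q: "expectation X = q"
  shows "integrable M (\<lambda>\<omega>. exp (s * X \<omega>))"
    and "expectation (\<lambda>\<omega>. exp (s * X \<omega>)) \<le> exp (q * (exp s - 1))"
proof -
  have "\<bar>X \<omega>\<bar> \<le> 1" if "\<omega> \<in> space M" for \<omega>
    using 01[OF that] by auto
  then have int: "integrable M X"
    using rv by (intro integrable_const_bound[of _ 1]) (auto intro!: AE_I2)
  have eq: "exp (s * X \<omega>) = 1 + X \<omega> * (exp s - 1)" if "\<omega> \<in> space M" for \<omega>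
    using 01[OF that] by auto
  have "integrable M (\<lambda>\<omega>. 1 + X \<omega> * (exp s - 1))" using int by simp
  then show "integrable M (\<lambda>\<omega>. exp (s * X \<omega>))"
    using eq by (simp cong: Bochner_Integration.integrable_cong)
  have "expectation (\<lambda>\<omega>. exp (s * X \<omega>)) = expectation (\<lambda>\<omega>. 1 + X \<omega> * (exp s - 1))"
    using eq by (intro Bochner_Integration.integral_cong) auto
  also have "\<dots> = 1 + q * (exp s - 1)" using int q by (simp add: prob_space)
  also have "\<dots> \<le> exp (q * (exp s - 1))" by simp
  finally show "expectation (\<lambda>\<omega>. exp (s * X \<omega>)) \<le> exp (q * (exp s - 1))" .
qed

text \<open>The Chernoff bound with s of either sign, so that it serves both tails.\<close>

lemma bernoulli_sum_tail:
  fixes X :: "'i \<Rightarrow> 'a \<Rightarrow> real"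
  assumes fin: "finite J" and indep: "indep_vars (\<lambda>_. borel) X J"
    and 01: "\<And>j \<omega>. j \<in> J \<Longrightarrow> \<omega> \<in> space M \<Longrightarrow> X j \<omega> \<in> {0, 1}"
    and q: "\<And>j. j \<in> J \<Longrightarrow> expectation (X j) = q"
  shows "prob {\<omega> \<in> space M. t < s * (\<Sum>j\<in>J. X j \<omega>)} \<le> exp (real (card J) * q * (exp s - 1) - t)"
proof -
  have rv: "random_variable borel (X j)" if "j \<in> J" for j
    using indep that by (auto simp: indep_vars_def)
  have meas[measurable]: "random_variable borel (\<lambda>\<omega>. \<Sum>j\<in>J. X j \<omega>)"
    using rv by (intro borel_measurable_sum)
  note mgf = bernoulli_mgf_le[OF rv 01 q]
  have indep': "indep_vars (\<lambda>_. borel) (\<lambda>j \<omega>. exp (s * X j \<omega>)) J"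
    by (rule indep_vars_compose2[OF indep, where Y = "\<lambda>_ x. exp (s * x)"]) measurable
  define Z where "Z = (\<lambda>\<omega>. \<Prod>j\<in>J. exp (s * X j \<omega>))"
  have Z: "Z \<omega> = exp (s * (\<Sum>j\<in>J. X j \<omega>))" for \<omega>
    by (simp add: Z_def sum_distrib_left exp_sum fin)
  have intZ: "integrable M Z"
    unfolding Z_def using mgf(1) by (intro indep_vars_integrable fin indep')
  have "expectation Z = (\<Prod>j\<in>J. expectation (\<lambda>\<omega>. exp (s * X j \<omega>)))"
    unfolding Z_def using mgf(1) by (intro indep_vars_lebesgue_integral fin indep')
  also have "\<dots> \<le> (\<Prod>j\<in>J. exp (q * (exp s - 1)))"
    using mgf(2) by (intro prod_mono) (auto intro!: integral_nonneg_AE)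
  also have "\<dots> = exp (real (card J) * q * (exp s - 1))"
    by (simp add: exp_of_nat_mult[symmetric] mult.assoc)
  finally have E: "expectation Z \<le> exp (real (card J) * q * (exp s - 1))" .
  have "prob {\<omega> \<in> space M. t < s * (\<Sum>j\<in>J. X j \<omega>)} \<le> prob {\<omega> \<in> space M. exp t \<le> Z \<omega>}"
    unfolding Z by (intro finite_measure_mono) auto
  also have "\<dots> \<le> expectation Z / exp t"
    by (intro integral_Markov_inequality_measure[where A = "{}"]) (auto simp: intZ[unfolded Z_def] Z_def prod_nonneg)
  also have "\<dots> \<le> exp (real (card J) * q * (exp s - 1) - t)"
    using E by (simp add: exp_diff divide_right_mono)
  finally show ?thesis .
qed

lemma exp_minus_quadratic: "exp (- s) \<le> 1 - s + s\<^sup>2 / 2" if "0 \<le> s" for s :: real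
proof -
  define f where "f t = 1 - t + t\<^sup>2 / 2 - exp (- t)" for t :: real
  have d: "(f has_real_derivative (t - 1 + exp (- t))) (at t)" for t
    unfolding f_def by (auto intro!: derivative_eq_intros)
  have "0 \<le> t - 1 + exp (- t)" for t :: real
    using exp_ge_add_one_self[of "- t"] by linarith
  then have "f 0 \<le> f s" using d that by (intro DERIV_nonneg_imp_nondecreasing[of 0 s f]) auto
  then show ?thesis by (simp add: f_def)
qed

text \<open>The deviation is parametrised by the exponent T, so that union bounds can be read off
  directly.\<close>

lemma bernoulli_sum_lower_tail:
  fixes X :: "'i \<Rightarrow> 'a \<Rightarrow> real"
  assumes fin: "finite J" and indep: "indep_vars (\<lambda>_. borel) X J"
    and 01: "\<And>j \<omega>. j \<in> J \<Longrightarrow> \<omega> \<in> space M \<Longrightarrow> X j \<omega> \<in> {0, 1}"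
    and q: "\<And>j. j \<in> J \<Longrightarrow> expectation (X j) = q" and "0 \<le> q" and "0 \<le> T"
  shows "prob {\<omega> \<in> space M. (\<Sum>j\<in>J. X j \<omega>) < real (card J) * q - sqrt (2 * (real (card J) * q) * T)}
    \<le> exp (- T)"
proof (cases "real (card J) * q = 0")
  \<comment> \<open>With mean 0 the threshold is 0, and a sum of 0/1 values is never below
    it.\<close>
  case True
  have "0 \<le> (\<Sum>j\<in>J. X j \<omega>)" if "\<omega> \<in> space M" for \<omega>
    using 01[OF _ that] by (intro sum_nonneg) fastforce
  then have empty: "{\<omega> \<in> space M. (\<Sum>j\<in>J. X j \<omega>) < real (card J) * q - sqrt (2 * (real (card J) * q) * T)} = {}"
    using True by (auto simp: not_less)
  show ?thesis unfolding empty by simp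
next
  case False
  define L where "L = real (card J) * q"
  have "L \<noteq> 0" "0 \<le> L" using False \<open>0 \<le> q\<close> unfolding L_def by auto
  then have L: "L > 0" by linarith
  \<comment> \<open>The minimiser of L s^2 / 2 - s sqrt (2 L T), whose minimum is - T.\<close>
  define s where "s = sqrt (2 * T / L)"
  show ?thesis
  proof (cases "T = 0")
    case True then show ?thesis by simp
  next
    case F: False
    then have s: "s > 0" "s\<^sup>2 = 2 * T / L" using L \<open>0 \<le> T\<close> by (auto simp: s_def)
    have "2 * T / L * (2 * L * T) = (2 * T)\<^sup>2" using L by (simp add: power2_eq_square)
    then have sq: "s * sqrt (2 * L * T) = 2 * T"
      using \<open>0 \<le> T\<close> by (simp only: s_def real_sqrt_mult[symmetric] real_sqrt_abs)
    have "prob {\<omega> \<in> space M. (\<Sum>j\<in>J. X j \<omega>) < L - sqrt (2 * L * T)} =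
      prob {\<omega> \<in> space M. - s * (L - sqrt (2 * L * T)) < - s * (\<Sum>j\<in>J. X j \<omega>)}"
      using s by simp
    also have "\<dots> \<le> exp (L * (exp (- s) - 1) - (- s * (L - sqrt (2 * L * T))))"
      unfolding L_def by (rule bernoulli_sum_tail[OF fin indep 01 q])
    also have "\<dots> \<le> exp (- T)"
    proof -
      have "L * (exp (- s) - 1) \<le> L * (s\<^sup>2 / 2 - s)"
        using exp_minus_quadratic[of s] s L by (intro mult_left_mono) auto
      also have "\<dots> = T - L * s" using s L by (simp add: field_simps)
      finally show ?thesis using sq by (simp add: algebra_simps)
    qed
    finally show ?thesis by (simp add: L_def)
  qed
qed

lemma bernoulli_sum_upper_tail:
  fixes X :: "'i \<Rightarrow> 'a \<Rightarrow> real"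
  assumes fin: "finite J" and indep: "indep_vars (\<lambda>_. borel) X J"
    and 01: "\<And>j \<omega>. j \<in> J \<Longrightarrow> \<omega> \<in> space M \<Longrightarrow> X j \<omega> \<in> {0, 1}"
    and q: "\<And>j. j \<in> J \<Longrightarrow> expectation (X j) = q" and "0 \<le> q" and "0 \<le> T"
  shows "prob {\<omega> \<in> space M. real (card J) * q + 2 * sqrt (real (card J) * q * T) + T < (\<Sum>j\<in>J. X j \<omega>)}
    \<le> exp (- T)"
proof -
  define L where "L = real (card J) * q"
  \<comment> \<open>For T < L this is the Gaussian choice of s. It is capped at 1 in the Poisson
    regime, because exp s <= 1 + s + s^2 is used only for s up to 1.\<close>
  define s where "s = (if T < L then sqrt (T / L) else 1)"
  define t where "t = L + 2 * sqrt (L * T) + T"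
  have L: "0 \<le> L" unfolding L_def using \<open>0 \<le> q\<close> by simp
  have s: "0 \<le> s" "s \<le> 1" using \<open>0 \<le> T\<close> by (auto simp: s_def)
  have key: "L * s\<^sup>2 + L * s - s * t \<le> - T"
  proof (cases "T < L")
    case True
    have 1: "L * s\<^sup>2 = T" using True \<open>0 \<le> T\<close> by (simp add: s_def)
    have "T / L * (L * T) = T\<^sup>2" using True \<open>0 \<le> T\<close> by (simp add: power2_eq_square)
    moreover have "s = sqrt (T / L)" using True by (simp add: s_def)
    ultimately have 2: "s * sqrt (L * T) = T"
      using \<open>0 \<le> T\<close> by (simp only: real_sqrt_mult[symmetric] real_sqrt_abs abs_of_nonneg)
    have "s * t = L * s + 2 * (s * sqrt (L * T)) + s * T" by (simp add: t_def algebra_simps)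
    then show ?thesis using 1 2 mult_nonneg_nonneg[OF s(1) \<open>0 \<le> T\<close>] by linarith
  next
    case False
    have "L \<le> sqrt (L * T)"
      using False L by (intro real_le_rsqrt) (simp add: power2_eq_square mult_left_mono)
    then show ?thesis using False L by (simp add: s_def t_def)
  qed
  show ?thesis
  proof (cases "s = 0")
    case True
    then have "T = 0" using \<open>0 \<le> T\<close> by (auto simp: s_def split: if_splits)
    then show ?thesis by simp
  next
    case False
    then have s: "0 < s" "s \<le> 1" using s by auto
    have "prob {\<omega> \<in> space M. t < (\<Sum>j\<in>J. X j \<omega>)} = prob {\<omega> \<in> space M. s * t < s * (\<Sum>j\<in>J. X j \<omega>)}"
      using s by simp
    also have "\<dots> \<le> exp (L * (exp s - 1) - s * t)"
      unfolding L_def by (rule bernoulli_sum_tail[OF fin indep 01 q])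
    also have "\<dots> \<le> exp (- T)"
    proof -
      have "L * (exp s - 1) \<le> L * (s + s\<^sup>2)"
        using exp_bound[of s] s L by (intro mult_left_mono) auto
      then show ?thesis using key by (simp add: algebra_simps)
    qed
    finally show ?thesis by (simp add: L_def t_def)
  qed
qed

text \<open>Injectivity makes the singletons {f j} disjoint groups of indices; independence of the
  groups is then projected to their single coordinates.\<close>

lemma indep_vars_reindex:
  assumes "indep_vars N X I" "inj_on f J" "f ` J \<subseteq> I"
  shows "indep_vars (\<lambda>j. N (f j)) (\<lambda>j. X (f j)) J"
proof -
  have "indep_vars (\<lambda>j. PiM {f j} N) (\<lambda>j \<omega>. restrict (\<lambda>i. X i \<omega>) {f j}) J"
    using assms by (intro indep_vars_restrict[OF assms(1)]) (auto simp: disjoint_family_on_def inj_on_def)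
  from indep_vars_compose2[OF this, where Y = "\<lambda>j g. g (f j)" and N = "\<lambda>j. N (f j)"]
  show ?thesis by (simp add: measurable_component_singleton)
qed

lemma prob_UN_le:
  assumes "finite I" "\<And>i. i \<in> I \<Longrightarrow> B i \<in> events" "\<And>i. i \<in> I \<Longrightarrow> prob (B i) \<le> e" "real (card I) \<le> k" "0 \<le> e"
  shows "prob (\<Union>i\<in>I. B i) \<le> k * e"
proof -
  have "prob (\<Union>i\<in>I. B i) \<le> (\<Sum>i\<in>I. prob (B i))"
    using assms(1,2) by (intro finite_measure_subadditive_finite) auto
  also have "\<dots> \<le> (\<Sum>i\<in>I. e)" using assms(3) by (rule sum_mono)
  also have "\<dots> \<le> k * e" using mult_right_mono[OF assms(4,5)] by simp
  finally show ?thesis .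
qed

end

section \<open>Operator norm and concentration\<close>

lemma euclidean_norm_sum: "v \<in> carrier_vec n \<Longrightarrow> euclidean_norm v = L2_set (\<lambda>i. v $ i) {..<n}"
  by (simp add: euclidean_norm_def L2_set_def scalar_prod_def power2_eq_square atLeast0LessThan)

lemma scalar_prod_le_euclidean_norm:
  assumes "v \<in> carrier_vec n" "w \<in> carrier_vec n"
  shows "\<bar>scalar_prod v w\<bar> \<le> euclidean_norm v * euclidean_norm w"
proof -
  have "\<bar>scalar_prod v w\<bar> \<le> (\<Sum>i<n. \<bar>v $ i\<bar> * \<bar>w $ i\<bar>)"
    using assms by (auto simp: scalar_prod_def atLeast0LessThan abs_mult[symmetric] intro: sum_abs)
  also have "\<dots> \<le> euclidean_norm v * euclidean_norm w"
    using assms by (simp add: euclidean_norm_sum L2_set_mult_ineq)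
  finally show ?thesis .
qed

text \<open>Without boundedness the supremum in \<open>operator_norm\<close> would not dominate its
  members. The sum of the row norms serves as a crude bound.\<close>

lemma euclidean_norm_mult_mat_bounded:
  assumes "B \<in> carrier_mat n n"
  shows "bdd_above ((\<lambda>v. euclidean_norm (B *\<^sub>v v)) ` {v \<in> carrier_vec n. euclidean_norm v = 1})"
proof (intro bdd_aboveI2)
  fix v assume v: "v \<in> {v \<in> carrier_vec n. euclidean_norm v = 1}"
  have "euclidean_norm (B *\<^sub>v v) = L2_set (\<lambda>i. scalar_prod (row B i) v) {..<n}"
    using assms v by (subst euclidean_norm_sum[of _ n]) (auto simp: L2_set_def)
  also have "\<dots> \<le> (\<Sum>i<n. \<bar>scalar_prod (row B i) v\<bar>)" by (rule L2_set_le_sum_abs)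
  also have "\<dots> \<le> (\<Sum>i<n. euclidean_norm (row B i))"
    using assms v scalar_prod_le_euclidean_norm[of "row B _" n v] by (intro sum_mono) fastforce
  finally show "euclidean_norm (B *\<^sub>v v) \<le> (\<Sum>i<n. euclidean_norm (row B i))" .
qed

text \<open>Normalise u and apply Cauchy-Schwarz.\<close>

lemma quad_form_le_operator_norm:
  assumes B: "B \<in> carrier_mat n n"
  shows "quad_form {..<n} (\<lambda>i j. B $$ (i, j)) u \<le> operator_norm B * (\<Sum>i<n. (u i)\<^sup>2)"
proof (cases "(\<Sum>i<n. (u i)\<^sup>2) = 0")
  \<comment> \<open>This includes n = 0, where the supremum runs over the empty set.\<close>
  case True
  then have "u i = 0" if "i < n" for i
    using that by (subst (asm) sum_nonneg_eq_0_iff) auto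
  then show ?thesis using True by (simp add: quad_form_def)
next
  case False
  define s where "s = sqrt (\<Sum>i<n. (u i)\<^sup>2)"
  have s2: "s\<^sup>2 = (\<Sum>i<n. (u i)\<^sup>2)" by (simp add: s_def sum_nonneg)
  have s: "s > 0" using False by (simp add: s_def less_le sum_nonneg)
  define v where "v = vec n (\<lambda>i. u i / s)"
  have v: "v \<in> carrier_vec n" by (simp add: v_def)
  have nv: "euclidean_norm v = 1"
    using s s2 False unfolding euclidean_norm_sum[OF v] L2_set_def
    by (simp add: v_def power_divide sum_divide_distrib[symmetric])
  have Bv: "B *\<^sub>v v \<in> carrier_vec n" using B v by simp
  have "quad_form {..<n} (\<lambda>i j. B $$ (i, j)) u = s\<^sup>2 * scalar_prod v (B *\<^sub>v v)"
    using B s by (simp add: quad_form_def scalar_prod_def atLeast0LessThan v_def sum_distrib_left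
        power2_eq_square field_simps)
  also have "\<dots> \<le> s\<^sup>2 * (euclidean_norm v * euclidean_norm (B *\<^sub>v v))"
    using scalar_prod_le_euclidean_norm[OF v Bv] by (intro mult_left_mono) auto
  also have "\<dots> \<le> s\<^sup>2 * operator_norm B"
    unfolding operator_norm_def using B v nv
    by (intro mult_left_mono) (auto intro!: cSUP_upper euclidean_norm_mult_mat_bounded)
  finally show ?thesis by (simp add: s2 mult.commute)
qed

section \<open>Transfer of the norm concentration to arbitrary sample spaces\<close>

text \<open>A finite set of outcomes: once the entries are measurable, every property of a matrix in
  it is an event, and measurability of the operator norm never has to be discussed.\<close>

definition zero_one_mats :: "nat \<Rightarrow> real mat set" where
  "zero_one_mats N = {B \<in> carrier_mat N N. \<forall>i<N. \<forall>j<N. B $$ (i, j) \<in> {0, 1}}"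

lemma finite_zero_one_mats: "finite (zero_one_mats N)"
proof -
  have "zero_one_mats N \<subseteq> (\<lambda>f. mat N N f) ` (PiE ({..<N} \<times> {..<N}) (\<lambda>_. {0, 1}))"
  proof
    fix B assume B: "B \<in> zero_one_mats N"
    then have "B = mat N N (restrict (\<lambda>p. B $$ p) ({..<N} \<times> {..<N}))"
      by (intro eq_matI) (auto simp: zero_one_mats_def)
    moreover have "restrict (\<lambda>p. B $$ p) ({..<N} \<times> {..<N}) \<in> PiE ({..<N} \<times> {..<N}) (\<lambda>_. {0, 1})"
      using B by (auto simp: zero_one_mats_def)
    ultimately show "B \<in> (\<lambda>f. mat N N f) ` (PiE ({..<N} \<times> {..<N}) (\<lambda>_. {0, 1}))" by blast
  qed
  then show ?thesis by (rule finite_subset) (auto intro!: finite_imageI finite_PiE)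
qed

text \<open>The preimage of a single matrix is a finite intersection of conditions on
  entries.\<close>

lemma measurable_zero_one_mats:
  assumes B: "\<And>\<omega>. \<omega> \<in> space M \<Longrightarrow> B \<omega> \<in> zero_one_mats N"
    and entry: "\<And>i j. i < N \<Longrightarrow> j < N \<Longrightarrow> (\<lambda>\<omega>. B \<omega> $$ (i, j)) \<in> borel_measurable M"
  shows "B \<in> measurable M (count_space (zero_one_mats N))"
proof (subst measurable_count_space_eq2[OF finite_zero_one_mats], intro conjI ballI)
  show "B \<in> space M \<rightarrow> zero_one_mats N" using B by auto
  fix b assume b: "b \<in> zero_one_mats N"
  have "B -` {b} \<inter> space M = {\<omega> \<in> space M. \<forall>i\<in>{..<N}. \<forall>j\<in>{..<N}. B \<omega> $$ (i, j) = b $$ (i, j)}"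
    using B b by (auto simp: zero_one_mats_def intro!: eq_matI) (metis carrier_matD(1,2))+
  also have "\<dots> \<in> sets M"
    using entry by (intro sets.sets_Collect_finite_All borel_measurable_eq) auto
  finally show "B -` {b} \<inter> space M \<in> sets M" .
qed

text \<open>For a nonempty index set, independence says that the joint law is the product of the
  marginals, and both laws are unchanged under the push-forward.\<close>

lemma indep_vars_distr:
  assumes "prob_space M" and T: "T \<in> measurable M N"
    and X: "\<And>i. i \<in> I \<Longrightarrow> X i \<in> measurable N (S i)"
  shows "prob_space.indep_vars (distr M N T) S X I \<longleftrightarrow> prob_space.indep_vars M S (\<lambda>i \<omega>. X i (T \<omega>)) I"
proof (cases "I = {}")
  case True
  interpret M: prob_space M by fact
  interpret D: prob_space "distr M N T" using T by (rule M.prob_space_distr)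
  show ?thesis using True by (simp add: M.indep_vars_def D.indep_vars_def M.indep_sets_def D.indep_sets_def)
next
  case False
  interpret M: prob_space M by fact
  interpret D: prob_space "distr M N T" using T by (rule M.prob_space_distr)
  have XT: "(\<lambda>\<omega>. X i (T \<omega>)) \<in> measurable M (S i)" if "i \<in> I" for i
    using measurable_compose[OF T X[OF that]] .
  have "distr (distr M N T) (Pi\<^sub>M I S) (\<lambda>x. \<lambda>i\<in>I. X i x) = distr M (Pi\<^sub>M I S) (\<lambda>\<omega>. \<lambda>i\<in>I. X i (T \<omega>))"
    using X T by (subst distr_distr) (auto simp: comp_def intro!: measurable_restrict)
  moreover have "Pi\<^sub>M I (\<lambda>i. distr (distr M N T) (S i) (X i)) = Pi\<^sub>M I (\<lambda>i. distr M (S i) (\<lambda>\<omega>. X i (T \<omega>)))"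
    using X T by (intro PiM_cong) (auto simp: distr_distr comp_def)
  ultimately show ?thesis
    using False X XT by (subst D.indep_vars_iff_distr_eq_PiM') (auto simp: M.indep_vars_iff_distr_eq_PiM')
qed

lemma concentration_general:
  assumes cc: "concentration_constants C C' c r" and N: "N \<ge> 1"
    and R: "random_01_symmetric M N B" and "\<sigma> \<ge> 0"
    and entry: "\<And>i j. i < N \<Longrightarrow> j < N \<Longrightarrow> (\<lambda>\<omega>. B \<omega> $$ (i, j)) \<in> borel_measurable M"
    and var: "\<And>i j. i < N \<Longrightarrow> j < N \<Longrightarrow> prob_space.variance M (\<lambda>\<omega>. B \<omega> $$ (i, j)) \<le> \<sigma>\<^sup>2"
    and sparse: "real N * \<sigma>\<^sup>2 \<ge> C' * ln (real N)"
  shows "prob_space.prob M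
              {\<omega> \<in> space M. operator_norm (B \<omega> - expected_mat M N B) \<le> C * \<sigma> * sqrt (real N)}
            \<ge> 1 - c * real N powr (- r)"
proof -
  interpret prob_space M using R by (simp add: random_01_symmetric_def)
  \<comment> \<open>The constants are only tested on measures on matrices, so pass to the law of \<open>B\<close>.\<close>
  define S where "S = {X \<in> zero_one_mats N. transpose_mat X = X \<and> (\<forall>i<N. X $$ (i, i) = 0)}"
  define D where "D = distr M (count_space S) B"
  have B01: "B \<omega> \<in> zero_one_mats N" and BS: "B \<omega> \<in> S" if "\<omega> \<in> space M" for \<omega>
    using R that by (auto simp: random_01_symmetric_def zero_one_mats_def S_def)
  have meas: "B \<in> measurable M (count_space S)"
    using measurable_zero_one_mats[OF B01 entry] BS
    by (auto simp: measurable_count_space_eq2_countable measurable_def S_def)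
  have D: "prob_space D" unfolding D_def using meas by (rule prob_space_distr)
  have E: "prob_space.expectation D (\<lambda>X. g X) = expectation (\<lambda>\<omega>. g (B \<omega>))" for g :: "real mat \<Rightarrow> real"
    unfolding D_def using meas by (intro integral_distr) auto
  have eD: "expected_mat D N (\<lambda>X. X) = expected_mat M N B"
    unfolding expected_mat_def by (simp add: E)
  have "prob_space.indep_vars D (\<lambda>_. borel) (\<lambda>(i, j) X. X $$ (i, j)) {(i, j). j < i \<and> i < N}"
    using R unfolding D_def random_01_symmetric_def
    by (subst indep_vars_distr[OF prob_space_axioms meas]) (auto simp: case_prod_unfold)
  \<comment> \<open>Symmetry and the zero diagonal are demanded at every outcome; they hold because
    the space of \<open>D\<close> is \<open>S\<close>.\<close>
  then have RD: "random_01_symmetric D N (\<lambda>X. X)"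
    using D by (auto simp: random_01_symmetric_def D_def S_def zero_one_mats_def)
  have "prob_space.prob D {X \<in> space D. operator_norm (X - expected_mat D N (\<lambda>X. X)) \<le> C * \<sigma> * sqrt (real N)}
       \<ge> 1 - c * real N powr (- r)"
    using cc N RD \<open>\<sigma> \<ge> 0\<close> var sparse unfolding concentration_constants_def
    by (simp add: E)
  also have "prob_space.prob D {X \<in> space D. operator_norm (X - expected_mat D N (\<lambda>X. X)) \<le> C * \<sigma> * sqrt (real N)}
     = prob {\<omega> \<in> space M. operator_norm (B \<omega> - expected_mat M N B) \<le> C * \<sigma> * sqrt (real N)}"
    unfolding eD using BS by (subst D_def, subst measure_distr[OF meas]) (auto simp: D_def intro!: arg_cong[where f = prob])
  finally show ?thesis .
qed

lemma (in prob_space) zero_one_mats_event: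
  assumes "\<And>\<omega>. \<omega> \<in> space M \<Longrightarrow> B \<omega> \<in> zero_one_mats N"
    and "\<And>i j. i < N \<Longrightarrow> j < N \<Longrightarrow> (\<lambda>\<omega>. B \<omega> $$ (i, j)) \<in> borel_measurable M"
  shows "{\<omega> \<in> space M. Q (B \<omega>)} \<in> events"
proof -
  have "B -` {X \<in> zero_one_mats N. Q X} \<inter> space M \<in> events"
    using measurable_zero_one_mats[OF assms] by (rule measurable_sets) auto
  also have "B -` {X \<in> zero_one_mats N. Q X} \<inter> space M = {\<omega> \<in> space M. Q (B \<omega>)}"
    using assms(1) by auto
  finally show ?thesis .
qed

section \<open>Certificates for SDP-1\<close>

lemma scalar_prod_mult_mat_vec_eq_quad_form:
  assumes "X \<in> carrier_mat n n" "v \<in> carrier_vec n"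
  shows "scalar_prod v (X *\<^sub>v v) = quad_form {..<n} (\<lambda>i j. X $$ (i, j)) (\<lambda>i. v $ i)"
  using assms by (simp add: quad_form_def scalar_prod_def atLeast0LessThan sum_distrib_left mult_ac)

lemma psd_quad_form_nonneg:
  assumes "psd n X"
  shows "0 \<le> quad_form {..<n} (\<lambda>i j. X $$ (i, j)) u"
proof -
  have X: "X \<in> carrier_mat n n" using assms by (simp add: psd_def)
  have "quad_form {..<n} (\<lambda>i j. X $$ (i, j)) u = quad_form {..<n} (\<lambda>i j. X $$ (i, j)) (\<lambda>i. vec n u $ i)"
    by (rule quad_form_cong) simp
  also have "\<dots> = scalar_prod (vec n u) (X *\<^sub>v vec n u)"
    by (rule scalar_prod_mult_mat_vec_eq_quad_form[symmetric, OF X]) simp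
  finally show ?thesis using assms by (simp add: psd_def)
qed

lemma block_eq_interval:
  fixes m K k :: nat
  assumes "k < K"
  shows "{i. i < m * K \<and> i div m = k} = (\<lambda>i. k * m + i) ` {..<m}"
proof (cases "m = 0")
  case False
  have "Suc k \<le> K" using assms by simp
  then have le: "k * m + m \<le> m * K" using mult_le_mono1[of "Suc k" K m] by (simp add: mult.commute)
  show ?thesis
  proof (intro equalityI subsetI)
    fix i assume "i \<in> {i. i < m * K \<and> i div m = k}"
    then have "i = k * m + i mod m" "i mod m < m" using False by auto
    then show "i \<in> (\<lambda>i. k * m + i) ` {..<m}" by blast
  qed (use le in \<open>auto simp: div_mult_self3\<close>)
qed simp

lemma card_block_nat:
  fixes m K k :: nat
  assumes "k < K"
  shows "card {i. i < m * K \<and> i div m = k} = m"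
  unfolding block_eq_interval[OF assms] by (subst card_image) auto

lemma div_block_less: "i < m * K \<Longrightarrow> i div m < K" for i m K :: nat
  by (simp add: less_mult_imp_div_less mult.commute)

lemma true_cluster_mat_carrier: "true_cluster_mat m K \<in> carrier_mat (m * K) (m * K)"
  by (simp add: true_cluster_mat_def kronecker_def all_ones_mat_def mult.commute)

lemma true_cluster_mat_entry:
  assumes "i < m * K" "j < m * K"
  shows "true_cluster_mat m K $$ (i, j) = of_bool (i div m = j div m)"
proof -
  have "m > 0" using assms by (cases m) auto
  then show ?thesis
    using assms div_block_less[of i m K] div_block_less[of j m K]
    by (auto simp: true_cluster_mat_def kronecker_def all_ones_mat_def mult.commute)
qed

lemma sum_same_label:
  assumes "finite I"
  shows "(\<Sum>i\<in>I. \<Sum>j | j \<in> I \<and> b j = b i. f i j) =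
    (\<Sum>k\<in>b ` I. \<Sum>i | i \<in> I \<and> b i = k. \<Sum>j | j \<in> I \<and> b j = k. (f i j :: real))"
  by (subst sum_over_labels[OF assms, of _ b]) (auto intro!: sum.cong)

text \<open>The form is the sum of the squares of the block sums.\<close>

lemma true_cluster_mat_psd: "psd (m * K) (true_cluster_mat m K)"
proof -
  let ?I = "{..<m * K}"
  have "0 \<le> quad_form ?I (\<lambda>i j. true_cluster_mat m K $$ (i, j)) v" for v
  proof -
    have "quad_form ?I (\<lambda>i j. true_cluster_mat m K $$ (i, j)) v =
      (\<Sum>i\<in>?I. \<Sum>j | j \<in> ?I \<and> j div m = i div m. v i * v j)"
      unfolding quad_form_def
      by (intro sum.cong sum.mono_neutral_cong_right) (auto simp: true_cluster_mat_entry)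
    also have "\<dots> = (\<Sum>k\<in>(\<lambda>i. i div m) ` ?I. (\<Sum>i | i \<in> ?I \<and> i div m = k. v i)\<^sup>2)"
      by (subst sum_same_label) (auto simp: power2_eq_square sum_product)
    finally show ?thesis by (simp add: sum_nonneg)
  qed
  then show ?thesis
    using true_cluster_mat_carrier[of m K]
    by (auto simp: psd_def scalar_prod_mult_mat_vec_eq_quad_form true_cluster_mat_entry intro!: eq_matI)
qed

lemma true_cluster_mat_feasible:
  assumes "K > 0"
  shows "true_cluster_mat m K \<in> sdp1_feasible (m * K) K"
proof -
  let ?X = "true_cluster_mat m K"
  have "?X *\<^sub>v all_ones_vec (m * K) = (real (m * K) / real K) \<cdot>\<^sub>v all_ones_vec (m * K)"
  proof (intro eq_vecI)
    fix i assume "i < dim_vec ((real (m * K) / real K) \<cdot>\<^sub>v all_ones_vec (m * K))"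
    then have i: "i < m * K" by (simp add: all_ones_vec_def)
    have "(?X *\<^sub>v all_ones_vec (m * K)) $ i = (\<Sum>j<m * K. of_bool (i div m = j div m))"
      using i true_cluster_mat_carrier[of m K]
      by (auto simp: scalar_prod_def all_ones_vec_def atLeast0LessThan true_cluster_mat_entry intro!: sum.cong)
    also have "\<dots> = real (card {j. j < m * K \<and> j div m = i div m})"
      by (subst sum.mono_neutral_cong_right[where h = "\<lambda>_. 1" and S = "{j. j < m * K \<and> j div m = i div m}"]) auto
    also have "\<dots> = real m" using i by (simp add: card_block_nat div_block_less)
    finally show "(?X *\<^sub>v all_ones_vec (m * K)) $ i = ((real (m * K) / real K) \<cdot>\<^sub>v all_ones_vec (m * K)) $ i"
      using i assms by (simp add: all_ones_vec_def)
  qed (use true_cluster_mat_carrier[of m K] in \<open>auto simp: all_ones_vec_def\<close>)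
  then show ?thesis
    using true_cluster_mat_carrier[of m K] true_cluster_mat_psd[of m K]
    by (auto simp: sdp1_feasible_def psd_def true_cluster_mat_entry)
qed

text \<open>The unit diagonal of X turns the diagonal of A into an additive constant, so the
  certificate may work with a zero diagonal.\<close>

lemma mat_trace_mult_off_diagonal:
  assumes A: "A \<in> carrier_mat n n" and X: "X \<in> carrier_mat n n" "transpose_mat X = X"
    and diag: "\<And>i. i < n \<Longrightarrow> X $$ (i, i) = 1"
    and a: "\<And>i j. i < n \<Longrightarrow> j < n \<Longrightarrow> a i j = (if i = j then 0 else A $$ (i, j))"
  shows "mat_trace (A * X) = (\<Sum>i<n. A $$ (i, i)) + (\<Sum>i<n. \<Sum>j<n. a i j * X $$ (i, j))"
proof -
  have sym: "X $$ (j, i) = X $$ (i, j)" if "i < n" "j < n" for i j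
    using X that by (metis carrier_matD index_transpose_mat(1))
  have "mat_trace (A * X) = (\<Sum>i<n. \<Sum>j<n. A $$ (i, j) * X $$ (j, i))"
    using A X by (simp add: mat_trace_def scalar_prod_def atLeast0LessThan)
  also have "\<dots> = (\<Sum>i<n. \<Sum>j<n. (if i = j then A $$ (i, j) else 0) + a i j * X $$ (i, j))"
    using diag a sym by (intro sum.cong) auto
  finally show ?thesis by (simp add: sum.distrib)
qed

lemma sdp1_unique_solution:
  assumes "K > 0" and A: "A \<in> carrier_mat (m * K) (m * K)"
    and a: "\<And>i j. i < m * K \<Longrightarrow> j < m * K \<Longrightarrow> a i j = (if i = j then 0 else A $$ (i, j))"
    and cert: "block_certificate {..<m * K} (\<lambda>i. i div m) a (real m) \<mu>"
  shows "sdp1_solutions (m * K) K A = {true_cluster_mat m K}"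
proof -
  let ?n = "m * K" and ?X0 = "true_cluster_mat m K"
  \<comment> \<open>t is the constant contributed by the diagonal of A, and t + d is the objective
    value of the cluster matrix.\<close>
  define t where "t = (\<Sum>i<?n. A $$ (i, i))"
  define d where "d = (\<Sum>i<?n. block_degree {..<?n} (\<lambda>i. i div m) a i (i div m))"
  have primal: "block_certificate_primal {..<?n} (\<lambda>i. i div m) a (real m) \<mu> (\<lambda>i j. X $$ (i, j))"
    and trace: "mat_trace (A * X) = t + (\<Sum>i<?n. \<Sum>j<?n. a i j * X $$ (i, j))"
    if "X \<in> sdp1_feasible ?n K" for X
  proof -
    have X: "X \<in> carrier_mat ?n ?n" "transpose_mat X = X" "psd ?n X"
      and row: "X *\<^sub>v all_ones_vec ?n = (real ?n / real K) \<cdot>\<^sub>v all_ones_vec ?n"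
      and diag: "\<And>i. i < ?n \<Longrightarrow> X $$ (i, i) = 1"
      and nonneg: "\<And>i j. i < ?n \<Longrightarrow> j < ?n \<Longrightarrow> 0 \<le> X $$ (i, j)"
      using that by (auto simp: sdp1_feasible_def)
    show "mat_trace (A * X) = t + (\<Sum>i<?n. \<Sum>j<?n. a i j * X $$ (i, j))"
      unfolding t_def using A X(1,2) diag a by (rule mat_trace_mult_off_diagonal)
    have sym: "X $$ (i, j) = X $$ (j, i)" if "i < ?n" "j < ?n" for i j
      using X that by (metis carrier_matD index_transpose_mat(1))
    have "(\<Sum>j<?n. X $$ (i, j)) = real m" if "i < ?n" for i
    proof -
      have "(\<Sum>j<?n. X $$ (i, j)) = (X *\<^sub>v all_ones_vec ?n) $ i"
        using X that by (simp add: scalar_prod_def all_ones_vec_def atLeast0LessThan)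
      also have "\<dots> = real m" unfolding row using that \<open>K > 0\<close> by (simp add: all_ones_vec_def)
      finally show ?thesis .
    qed
    then show "block_certificate_primal {..<?n} (\<lambda>i. i div m) a (real m) \<mu> (\<lambda>i j. X $$ (i, j))"
      using cert sym diag nonneg psd_quad_form_nonneg[OF X(3)]
      by (auto simp: block_certificate_primal_def block_certificate_primal_axioms_def)
  qed
  have feas: "?X0 \<in> sdp1_feasible ?n K" by (rule true_cluster_mat_feasible) fact
  have "(\<Sum>j<?n. a i j * ?X0 $$ (i, j)) = block_degree {..<?n} (\<lambda>i. i div m) a i (i div m)" if "i < ?n" for i
    unfolding block_degree_def using that
    by (intro sum.mono_neutral_cong_right) (auto simp: true_cluster_mat_entry)
  then have tr0: "mat_trace (A * ?X0) = t + d"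
    unfolding trace[OF feas] d_def by simp
  have le: "mat_trace (A * X) \<le> t + d" if "X \<in> sdp1_feasible ?n K" for X
    using block_certificate_primal.inner_a_le[OF primal[OF that]] trace[OF that] by (simp add: d_def)
  have uniq: "X = ?X0" if X: "X \<in> sdp1_feasible ?n K" and opt: "t + d \<le> mat_trace (A * X)" for X
  proof (rule eq_matI)
    fix i j assume "i < dim_row ?X0" "j < dim_col ?X0"
    then have ij: "i < ?n" "j < ?n" using true_cluster_mat_carrier[of m K] by auto
    have "X $$ (i, j) = of_bool (i div m = j div m)"
      using block_certificate_primal.optimal_unique[OF primal[OF X], of i j] opt trace[OF X] ij
      by (simp add: d_def)
    then show "X $$ (i, j) = ?X0 $$ (i, j)" using ij by (simp add: true_cluster_mat_entry)
  qed (use X true_cluster_mat_carrier[of m K] in \<open>auto simp: sdp1_feasible_def\<close>)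
  show ?thesis
  proof (intro equalityI subsetI)
    fix X assume "X \<in> sdp1_solutions ?n K A"
    then have "X \<in> sdp1_feasible ?n K" "t + d \<le> mat_trace (A * X)"
      using feas tr0 by (auto simp: sdp1_solutions_def)
    then show "X \<in> {?X0}" using uniq by blast
  next
    fix X assume "X \<in> {?X0}"
    then show "X \<in> sdp1_solutions ?n K A" using feas le tr0 by (simp add: sdp1_solutions_def)
  qed
qed

text \<open>The block-constant mean vanishes against u; as \<open>a\<close> is centred with zero
  diagonal, only the correction - P k k survives. Fluctuations inside and between blocks are bounded
  separately, so that each block enters with its own s k.\<close>

lemma balanced_quad_form_bound:
  fixes a P :: "nat \<Rightarrow> nat \<Rightarrow> real" and s :: "nat \<Rightarrow> real" and t :: real and m K :: nat
  defines "z \<equiv> \<lambda>i j. a i j - (if i = j then 0 else P (i div m) (j div m))"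
  assumes blocks: "\<And>k v. k < K \<Longrightarrow>
      quad_form {..<m} (\<lambda>i j. z (k * m + i) (k * m + j)) v \<le> s k * (\<Sum>i<m. (v i)\<^sup>2)"
    and off: "\<And>v. quad_form {..<m * K} (\<lambda>i j. if i div m = j div m then 0 else z i j) v
      \<le> t * (\<Sum>i<m * K. (v i)\<^sup>2)"
    and u: "\<And>l. (\<Sum>i | i \<in> {..<m * K} \<and> i div m = l. u i) = 0"
  shows "quad_form {..<m * K} a u \<le> (\<Sum>i<m * K. (s (i div m) + t - P (i div m) (i div m)) * (u i)\<^sup>2)"
proof -
  let ?I = "{..<m * K}" and ?b = "\<lambda>i::nat. i div m"
  have blk: "?b ` ?I \<subseteq> {..<K}" by (auto simp: div_block_less)
  have split: "quad_form ?I a u = quad_form ?I (\<lambda>i j. if ?b i = ?b j then 0 else z i j) u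
      + (\<Sum>i\<in>?I. \<Sum>j\<in>?I. if ?b i = ?b j then z i j * u i * u j else 0)
      + (\<Sum>i\<in>?I. \<Sum>j\<in>?I. P (?b i) (?b j) * u i * u j)
      - (\<Sum>i\<in>?I. \<Sum>j\<in>?I. if i = j then P (?b i) (?b i) * (u i)\<^sup>2 else 0)"
    unfolding quad_form_def sum.distrib[symmetric] sum_subtractf[symmetric]
    by (intro sum.cong refl) (auto simp: z_def algebra_simps power2_eq_square)
  have mean: "(\<Sum>i\<in>?I. \<Sum>j\<in>?I. P (?b i) (?b j) * u i * u j) = 0"
  proof (rule sum.neutral, rule ballI)
    fix i
    have "(\<Sum>j\<in>?I. P (?b i) (?b j) * u i * u j) =
        (\<Sum>l\<in>?b ` ?I. \<Sum>j | j \<in> ?I \<and> ?b j = l. P (?b i) l * u i * u j)"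
      by (subst sum_over_labels[of ?I _ ?b]) (auto intro!: sum.cong)
    also have "\<dots> = (\<Sum>l\<in>?b ` ?I. P (?b i) l * u i * (\<Sum>j | j \<in> ?I \<and> ?b j = l. u j))"
      by (simp only: sum_distrib_left)
    also have "\<dots> = 0" by (simp only: u mult_zero_right sum.neutral_const)
    finally show "(\<Sum>j\<in>?I. P (?b i) (?b j) * u i * u j) = 0" .
  qed
  have diag: "(\<Sum>i\<in>?I. \<Sum>j\<in>?I. if i = j then P (?b i) (?b i) * (u i)\<^sup>2 else 0) =
      (\<Sum>i\<in>?I. P (?b i) (?b i) * (u i)\<^sup>2)" by simp
  have "(\<Sum>i\<in>?I. \<Sum>j\<in>?I. if ?b i = ?b j then z i j * u i * u j else 0) =
      (\<Sum>i\<in>?I. \<Sum>j | j \<in> ?I \<and> ?b j = ?b i. z i j * u i * u j)"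
    by (intro sum.cong sum.mono_neutral_cong_right) auto
  also have "\<dots> = (\<Sum>k\<in>?b ` ?I. \<Sum>i | i \<in> ?I \<and> ?b i = k. \<Sum>j | j \<in> ?I \<and> ?b j = k. z i j * u i * u j)"
    by (rule sum_same_label) simp
  also have "\<dots> \<le> (\<Sum>k\<in>?b ` ?I. \<Sum>i | i \<in> ?I \<and> ?b i = k. s k * (u i)\<^sup>2)"
  proof (rule sum_mono)
    fix k assume "k \<in> ?b ` ?I"
    then have k: "k < K" using blk by auto
    have set: "{i. i \<in> ?I \<and> ?b i = k} = (\<lambda>i. k * m + i) ` {..<m}"
      using block_eq_interval[OF k, of m] by simp
    show "(\<Sum>i | i \<in> ?I \<and> ?b i = k. \<Sum>j | j \<in> ?I \<and> ?b j = k. z i j * u i * u j)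
      \<le> (\<Sum>i | i \<in> ?I \<and> ?b i = k. s k * (u i)\<^sup>2)"
      using blocks[OF k, of "\<lambda>i. u (k * m + i)"] unfolding set
      by (simp add: sum.reindex quad_form_def sum_distrib_left)
  qed
  also have "\<dots> = (\<Sum>i\<in>?I. s (?b i) * (u i)\<^sup>2)"
    using sum_over_labels[of ?I "\<lambda>i. s (?b i) * (u i)\<^sup>2" ?b] by simp
  finally have same: "(\<Sum>i\<in>?I. \<Sum>j\<in>?I. if ?b i = ?b j then z i j * u i * u j else 0)
      \<le> (\<Sum>i\<in>?I. s (?b i) * (u i)\<^sup>2)" .
  have rhs: "(\<Sum>i<m * K. (s (i div m) + t - P (i div m) (i div m)) * (u i)\<^sup>2) =
      (\<Sum>i\<in>?I. s (?b i) * (u i)\<^sup>2) + t * (\<Sum>i\<in>?I. (u i)\<^sup>2) - (\<Sum>i\<in>?I. P (?b i) (?b i) * (u i)\<^sup>2)"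
    unfolding sum_distrib_left sum.distrib[symmetric] sum_subtractf[symmetric]
    by (intro sum.cong refl) (simp add: algebra_simps)
  show ?thesis unfolding rhs split mean diag using same off[of u] by linarith
qed

text \<open>The two objectives differ by a constant on the feasible set. This allows A to be
  replaced by a 0/1 matrix when the event of recovery is shown to be measurable.\<close>

lemma sdp1_solutions_cong_off_diagonal:
  assumes A: "A \<in> carrier_mat n n" "A' \<in> carrier_mat n n"
    and eq: "\<And>i j. i < n \<Longrightarrow> j < n \<Longrightarrow> i \<noteq> j \<Longrightarrow> A $$ (i, j) = A' $$ (i, j)"
  shows "sdp1_solutions n K A = sdp1_solutions n K A'"
proof -
  define t where "t B = (\<Sum>i<n. B $$ (i, i))" for B :: "real mat"
  have tr: "mat_trace (B * X) = t B + (\<Sum>i<n. \<Sum>j<n. (if i = j then 0 else A $$ (i, j)) * X $$ (i, j))"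
    if "X \<in> sdp1_feasible n K" "B \<in> {A, A'}" for X B
    unfolding t_def using that A eq
    by (intro mat_trace_mult_off_diagonal) (auto simp: sdp1_feasible_def)
  have "mat_trace (A * Y) \<le> mat_trace (A * X) \<longleftrightarrow> mat_trace (A' * Y) \<le> mat_trace (A' * X)"
    if "X \<in> sdp1_feasible n K" "Y \<in> sdp1_feasible n K" for X Y
    using tr[OF that(1)] tr[OF that(2)] by simp
  then show ?thesis unfolding sdp1_solutions_def by blast
qed

section \<open>Numerical margins\<close>

text \<open>Iterate \<open>n \<ge> 144 ln n\<close>, starting from \<open>ln n \<ge> ln 2\<close>.\<close>
lemma block_size_log_bound:
  fixes m K n :: nat and D p :: real
  assumes "n = m * K" "2 \<le> K" "1 \<le> m" "p \<le> 1" "72 \<le> D"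
    and "D * ln (real n) \<le> real m * p"
  shows "6 \<le> ln (real n)"
proof -
  have "2 \<le> real K" using assms(2) by simp
  then have n2: "2 * real m \<le> real n"
    unfolding assms(1) by (simp add: mult_left_mono mult.commute[of _ "real m"])
  have mp: "real m * p \<le> real m" using assms(4) by (simp add: mult_left_le)
  have L0: "0 \<le> ln (real n)" using n2 assms(3) by (intro ln_ge_zero) simp
  have m: "72 * ln (real n) \<le> real m"
    using mult_right_mono[OF assms(5) L0] assms(6) mp by linarith
  have step: "ln (real n) \<ge> 2 / 3 * real j" if "2 ^ j \<le> real n" for j :: nat
  proof -
    have "2 / 3 * real j \<le> real j * ln 2"
      using mult_left_mono[OF ln2_ge_two_thirds, of "real j"] by (simp add: mult.commute)
    also have "\<dots> = ln (2 ^ j)" by (simp add: ln_realpow)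
    also have "\<dots> \<le> ln (real n)" using that by (intro ln_mono) auto
    finally show ?thesis .
  qed
  have "2 / 3 \<le> ln (real n)" using step[of 1] n2 assms(3) by simp
  \<comment> \<open>With ln 2 >= 2/3, the chain is n >= 2, then n >= 96 >= 2^6, then n >= 576 >=
    2^9, each power giving the next bound on ln n.\<close>
  then have "96 \<le> real n" using m n2 by simp
  then have "4 \<le> ln (real n)" using step[of 6] by simp
  then have "576 \<le> real n" using m n2 by simp
  then show ?thesis using step[of 9] by simp
qed

text \<open>The gap forces C2 sqrt (y L) <= y; divide by sqrt y and square. Here y and x stand for
  the unscaled m p_k and m q*_k, and L for log n.\<close>

lemma gap_imp_degree_bound:
  fixes y x L C2 R :: real
  assumes "0 \<le> L" "0 \<le> y" "0 \<le> x" "0 < C2" "0 \<le> R"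
    and gap: "R < y - x - C2 * (sqrt (y * L) + sqrt (x * L))"
  shows "C2\<^sup>2 * L \<le> y"
proof -
  have "0 \<le> C2 * sqrt (x * L)" "0 \<le> C2 * sqrt (y * L)" using assms by simp_all
  then have le: "C2 * sqrt (y * L) \<le> y" and y0: "0 < y"
    using gap assms(3,5) unfolding distrib_left by linarith+
  from le have "C2 * sqrt L * sqrt y \<le> sqrt y * sqrt y"
    using y0 by (simp add: real_sqrt_mult mult_ac)
  then have "C2 * sqrt L \<le> sqrt y" by (rule mult_right_le_imp_le) (use y0 in simp)
  then have "(C2 * sqrt L)\<^sup>2 \<le> (sqrt y)\<^sup>2" using assms by (intro power_mono) auto
  then show ?thesis using assms(1) y0 by (simp add: power_mult_distrib)
qed

lemma square_constant_bound:
  fixes C2 c2 :: real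
  assumes "0 < c2" "6 * sqrt (2 * (c2 + 1)) \<le> C2"
  shows "72 * (c2 + 1) \<le> C2\<^sup>2"
proof -
  have "72 * (c2 + 1) = (6 * sqrt (2 * (c2 + 1)))\<^sup>2" using assms by (simp add: power_mult_distrib)
  also have "\<dots> \<le> C2\<^sup>2" using assms by (intro power_mono) auto
  finally show ?thesis .
qed

text \<open>All error terms together use at most 5/6 of C2 sqrt (y L). The remaining sixth is at
  least C2^2 L / 6, hence at least 12 (c2 + 1) L. N bounds the norm of the part between
  blocks.\<close>

lemma dual_margin:
  fixes y x L C C2 c1 c2 C' R N :: real
  assumes L: "6 \<le> L" and y: "0 \<le> y" and x: "0 \<le> x" and C: "0 < C"
    and c1: "0 < c1" and c2: "0 < c2" and R: "0 \<le> R"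
    and C2a: "sqrt (4 * (c1 + 1)) + C \<le> C2" and C2b: "6 * sqrt (2 * (c2 + 1)) \<le> C2"
    and gap: "R < y - x - C2 * (sqrt (y * L) + sqrt (x * L))"
    and C': "C' * L \<le> y" and N: "N \<le> R + C * sqrt (C' * L)"
  shows "x + C2 * sqrt (x * L) + 12 * (c2 + 1) * L
    < y - sqrt (2 * y * ((c1 + 1) * L)) - C * sqrt y - N"
proof -
  have s1: "sqrt (2 * y * ((c1 + 1) * L)) = sqrt (2 * (c1 + 1)) * sqrt (y * L)"
    by (simp add: real_sqrt_mult[symmetric] mult_ac)
  have "sqrt (2 * (c1 + 1)) \<le> 5 / 6 * sqrt (4 * (c1 + 1))"
    using c1 by (intro real_le_lsqrt) (auto simp: power_mult_distrib power_divide)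
  then have 1: "sqrt (2 * y * ((c1 + 1) * L)) \<le> 5 / 6 * sqrt (4 * (c1 + 1)) * sqrt (y * L)"
    unfolding s1 using y L by (intro mult_right_mono) auto
  \<comment> \<open>From L >= 6, as 1 / sqrt 6 <= 5 / 12; the two roots added below then make up 5 /
    6.\<close>
  have sy: "sqrt y \<le> 5 / 12 * sqrt (y * L)"
    using y L mult_left_mono[OF L y] by (intro real_le_lsqrt) (auto simp: power_mult_distrib power_divide)
  have "sqrt (C' * L) \<le> sqrt y" using C' by simp
  then have "sqrt y + sqrt (C' * L) \<le> 5 / 6 * sqrt (y * L)" using sy by linarith
  from mult_left_mono[OF this, of C]
  have 2: "C * sqrt y + C * sqrt (C' * L) \<le> 5 / 6 * C * sqrt (y * L)"
    using C by (simp add: distrib_left)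
  have "0 < sqrt (2 * (c2 + 1))" using c2 by simp
  then have C2: "0 < C2" using C2b by linarith
  have "5 / 6 * sqrt (4 * (c1 + 1)) * sqrt (y * L) + 5 / 6 * C * sqrt (y * L) \<le> 5 / 6 * C2 * sqrt (y * L)"
    using C2a y L mult_right_mono[OF C2a, of "5 / 6 * sqrt (y * L)"] by (simp add: algebra_simps)
  then have 3: "sqrt (2 * y * ((c1 + 1) * L)) + C * sqrt y + C * sqrt (C' * L) \<le> 5 / 6 * C2 * sqrt (y * L)"
    using 1 2 by linarith
  have "sqrt (C2\<^sup>2 * L * L) \<le> sqrt (y * L)"
    using gap_imp_degree_bound[OF _ y x C2 R gap] L by (intro real_sqrt_le_mono mult_right_mono) auto
  moreover have "C2\<^sup>2 * L * L = (C2 * L)\<^sup>2" by (simp add: power2_eq_square)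
  ultimately have "C2 * L \<le> sqrt (y * L)" using L C2 by (simp only: real_sqrt_abs)
  then have 4: "C2\<^sup>2 * L \<le> C2 * sqrt (y * L)" using C2 by (simp add: power2_eq_square mult.assoc)
  have "72 * (c2 + 1) * L \<le> C2\<^sup>2 * L"
    using square_constant_bound[OF c2 C2b] L by (intro mult_right_mono) auto
  then have "72 * (c2 + 1) * L \<le> C2 * sqrt (y * L)" using 4 by linarith
  then show ?thesis using gap 3 N by (simp add: algebra_simps)
qed

text \<open>This is where 6 sqrt (2 (c2 + 1)) comes from: two upper tails cost 4 sqrt (x T) and the
  block total sqrt (2 x T). By T <= 2 (c2 + 1) L they sum to at most 6 sqrt 2 w; the remaining 2 T
  is covered by 12 (c2 + 1) L.\<close>

lemma slack_margin:
  fixes x L C2 c2 U1 U2 d1 d2 e T :: real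
  assumes "0 \<le> x" "0 \<le> L" "0 < c2" and C2: "6 * sqrt (2 * (c2 + 1)) \<le> C2" and T: "T = (c2 + 2) * L"
    and U1: "x + C2 * sqrt (x * L) + 12 * (c2 + 1) * L < U1"
    and U2: "x + C2 * sqrt (x * L) + 12 * (c2 + 1) * L < U2"
    and d1: "d1 \<le> x + 2 * sqrt (x * T) + T" and d2: "d2 \<le> x + 2 * sqrt (x * T) + T"
    and e: "x - sqrt (2 * x * T) \<le> e"
  shows "0 < U1 / 2 + U2 / 2 - d1 - d2 + e"
proof -
  define w where "w = sqrt (c2 + 1) * sqrt (x * L)"
  have w0: "0 \<le> w" using assms by (simp add: w_def)
  have "x * T \<le> 2 * ((c2 + 1) * (x * L))"
    using assms by (simp add: T algebra_simps mult_left_mono)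
  then have "sqrt (x * T) \<le> sqrt (2 * ((c2 + 1) * (x * L)))" by simp
  then have 1: "sqrt (x * T) \<le> sqrt 2 * w" by (simp add: w_def real_sqrt_mult)
  have "sqrt (2 * x * T) = sqrt 2 * sqrt (x * T)" by (simp add: real_sqrt_mult)
  also have "\<dots> \<le> sqrt 2 * (sqrt 2 * w)" using 1 by (intro mult_left_mono) auto
  finally have 2: "sqrt (2 * x * T) \<le> 2 * w" by (simp add: mult.assoc[symmetric])
  have "6 * sqrt 2 * w = 6 * sqrt (2 * (c2 + 1)) * sqrt (x * L)"
    by (simp only: w_def real_sqrt_mult mult.assoc)
  also have "\<dots> \<le> C2 * sqrt (x * L)" using C2 assms by (intro mult_right_mono) auto
  finally have 3: "6 * sqrt 2 * w \<le> C2 * sqrt (x * L)" .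
  have "1 \<le> sqrt (2::real)" by simp
  from mult_right_mono[OF this w0] have 4: "w \<le> sqrt 2 * w" by simp
  have 5: "T \<le> 2 * ((c2 + 1) * L)" using assms by (simp add: T algebra_simps)
  have "0 \<le> (c2 + 1) * L" using assms by simp
  then show ?thesis using U1 U2 d1 d2 e 1 2 3 4 5 by argo
qed

section \<open>The balanced block model\<close>

text \<open>Reading only the entries above the diagonal makes \<open>adj\<close> symmetric also outside \<open>space M\<close>.\<close>
definition adj :: "('a \<Rightarrow> real mat) \<Rightarrow> nat \<Rightarrow> nat \<Rightarrow> 'a \<Rightarrow> real" where
  "adj A i j \<omega> = (if i = j then 0 else A \<omega> $$ (min i j, max i j))"

text \<open>f selects vertices and P masks entries. One definition thus covers the diagonal blocks
  (f a shift), the part between blocks (f the identity with a mask), and the whole matrix with zero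
  diagonal.\<close>

definition adj_sub :: "('a \<Rightarrow> real mat) \<Rightarrow> nat \<Rightarrow> (nat \<Rightarrow> nat) \<Rightarrow> (nat \<Rightarrow> nat \<Rightarrow> bool) \<Rightarrow> 'a \<Rightarrow> real mat" where
  "adj_sub A N f P \<omega> = mat N N (\<lambda>(i, j). if P i j then adj A (f i) (f j) \<omega> else 0)"

locale block_model = prob_space M for M :: "'a measure" +
  fixes A :: "'a \<Rightarrow> real mat" and m K :: nat and \<Psi> :: "real mat"
  assumes model: "BM_bal M m K \<Psi> A"
begin

lemma psi_bounds: "k < K \<Longrightarrow> l < K \<Longrightarrow> 0 \<le> \<Psi> $$ (k, l)" "k < K \<Longrightarrow> l < K \<Longrightarrow> \<Psi> $$ (k, l) \<le> 1"
  and psi_carrier: "\<Psi> \<in> carrier_mat K K"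
  and psi_sym: "k < K \<Longrightarrow> l < K \<Longrightarrow> \<Psi> $$ (k, l) = \<Psi> $$ (l, k)"
proof -
  have *: "connectivity_mat K \<Psi>" using model by (simp add: BM_bal_def)
  then show "k < K \<Longrightarrow> l < K \<Longrightarrow> 0 \<le> \<Psi> $$ (k, l)" "k < K \<Longrightarrow> l < K \<Longrightarrow> \<Psi> $$ (k, l) \<le> 1"
    and "\<Psi> \<in> carrier_mat K K" by (auto simp: connectivity_mat_def)
  show "k < K \<Longrightarrow> l < K \<Longrightarrow> \<Psi> $$ (k, l) = \<Psi> $$ (l, k)"
    using * unfolding connectivity_mat_def by (metis carrier_matD index_transpose_mat(1))
qed

lemma A_carrier: "\<omega> \<in> space M \<Longrightarrow> A \<omega> \<in> carrier_mat (m * K) (m * K)"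
  using model by (simp add: BM_bal_def)

lemma A_indep: "indep_vars (\<lambda>_. borel) (\<lambda>(i, j) \<omega>. A \<omega> $$ (i, j)) {(i, j). i < j \<and> j < m * K}"
  using model by (simp add: BM_bal_def)

lemma A_sym:
  assumes "\<omega> \<in> space M" "i < m * K" "j < m * K"
  shows "A \<omega> $$ (i, j) = A \<omega> $$ (j, i)"
proof -
  have "transpose_mat (A \<omega>) = A \<omega>" using model assms(1) by (simp add: BM_bal_def)
  then show ?thesis using A_carrier[OF assms(1)] assms(2,3) by (metis carrier_matD index_transpose_mat(1))
qed

lemma adj_eq:
  assumes "\<omega> \<in> space M" "i < m * K" "j < m * K"
  shows "adj A i j \<omega> = (if i = j then 0 else A \<omega> $$ (i, j))"
proof (cases "i \<le> j")
  case False
  then have "adj A i j \<omega> = A \<omega> $$ (j, i)" by (simp add: adj_def)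
  also have "\<dots> = A \<omega> $$ (i, j)" by (rule A_sym) fact+
  finally show ?thesis using False by simp
qed (simp add: adj_def)

lemma adj_sym: "adj A i j \<omega> = adj A j i \<omega>"
  by (simp add: adj_def min.commute max.commute)

lemma adj_01: "\<omega> \<in> space M \<Longrightarrow> i < m * K \<Longrightarrow> j < m * K \<Longrightarrow> adj A i j \<omega> \<in> {0, 1}"
  using model by (auto simp: BM_bal_def adj_def min_def max_def)

lemma adj_measurable:
  assumes "i < m * K" "j < m * K"
  shows "adj A i j \<in> borel_measurable M"
proof (cases "i = j")
  case True
  then show ?thesis by (simp add: adj_def[abs_def])
next
  case False
  have "(\<lambda>\<omega>. A \<omega> $$ (min i j, max i j)) \<in> borel_measurable M"
    using A_indep assms False unfolding indep_vars_def
    by (auto simp: min_def max_def dest!: bspec[of _ _ "(min i j, max i j)"])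
  then show ?thesis using False by (simp add: adj_def[abs_def])
qed

lemma adj_expectation:
  assumes "i < m * K" "j < m * K"
  shows "expectation (adj A i j) = (if i = j then 0 else \<Psi> $$ (i div m, j div m))"
proof (cases "i = j")
  case False
  have "expectation (adj A i j) = expectation (\<lambda>\<omega>. A \<omega> $$ (i, j))"
    using assms False by (intro Bochner_Integration.integral_cong) (auto simp: adj_eq)
  then show ?thesis using model assms False by (simp add: BM_bal_def)
qed (simp add: adj_def[abs_def])

text \<open>J holds each edge in at most one orientation, so sorting the pairs is injective and maps
  J above the diagonal.\<close>

lemma adj_indep:
  assumes J: "\<And>i j. (i, j) \<in> J \<Longrightarrow> i < m * K \<and> j < m * K \<and> i \<noteq> j \<and> (j, i) \<notin> J"
  shows "indep_vars (\<lambda>_. borel) (\<lambda>p. adj A (fst p) (snd p)) J"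
proof -
  define f where "f p = (min (fst p) (snd p), max (fst p) (snd p))" for p :: "nat \<times> nat"
  have "inj_on f J"
  proof (rule inj_onI, clarify)
    fix i j i' j' assume ij: "(i, j) \<in> J" "(i', j') \<in> J" and "f (i, j) = f (i', j')"
    then have "i = i' \<and> j = j' \<or> i = j' \<and> j = i'"
      by (auto simp: f_def min_def max_def split: if_splits)
    then show "i = i' \<and> j = j'" using J[OF ij(1)] ij(2) by blast
  qed
  moreover have "f ` J \<subseteq> {(i, j). i < j \<and> j < m * K}"
  proof (rule image_subsetI)
    fix p assume "p \<in> J"
    then obtain i j where p: "p = (i, j)" "(i, j) \<in> J" by (cases p) auto
    then have "i < m * K" "j < m * K" "i \<noteq> j" using J by blast+
    then show "f p \<in> {(i, j). i < j \<and> j < m * K}" by (simp add: p(1) f_def min_def max_def)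
  qed
  ultimately have *: "indep_vars (\<lambda>_. borel) (\<lambda>p. (\<lambda>(i, j) \<omega>. A \<omega> $$ (i, j)) (f p)) J"
    by (rule indep_vars_reindex[OF A_indep])
  have "(\<lambda>(i, j) \<omega>. A \<omega> $$ (i, j)) (f p) = adj A (fst p) (snd p)" if p: "p \<in> J" for p
  proof -
    have "fst p \<noteq> snd p" using J[of "fst p" "snd p"] p unfolding prod.collapse by blast
    then show ?thesis by (simp add: f_def adj_def[abs_def])
  qed
  from indep_vars_cong[THEN iffD1, OF refl this refl *] show ?thesis .
qed

section \<open>Norm tails for masked submatrices\<close>

lemma adj_sub_entry:
  "i < N \<Longrightarrow> j < N \<Longrightarrow> adj_sub A N f P \<omega> $$ (i, j) = (if P i j then adj A (f i) (f j) \<omega> else 0)"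
  by (simp add: adj_sub_def)

context
  fixes N :: nat and f :: "nat \<Rightarrow> nat" and P :: "nat \<Rightarrow> nat \<Rightarrow> bool"
  assumes range: "\<And>i. i < N \<Longrightarrow> f i < m * K"
    and inj: "inj_on f {..<N}"
    and P_sym: "\<And>i j. P i j = P j i"
begin

lemma adj_sub_zero_one: "\<omega> \<in> space M \<Longrightarrow> adj_sub A N f P \<omega> \<in> zero_one_mats N"
  using adj_01 range by (auto simp: zero_one_mats_def adj_sub_def)

lemma adj_sub_measurable:
  assumes "i < N" "j < N"
  shows "(\<lambda>\<omega>. adj_sub A N f P \<omega> $$ (i, j)) \<in> borel_measurable M"
  using assms range adj_measurable[of "f i" "f j"] by (cases "P i j") (auto simp: adj_sub_entry)

lemma adj_sub_event: "{\<omega> \<in> space M. Q (adj_sub A N f P \<omega>)} \<in> events"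
  by (rule zero_one_mats_event[OF adj_sub_zero_one adj_sub_measurable])

lemma adj_sub_expected:
  "expected_mat M N (adj_sub A N f P) =
    mat N N (\<lambda>(i, j). if P i j \<and> i \<noteq> j then \<Psi> $$ (f i div m, f j div m) else 0)"
proof (intro eq_matI)
  fix i j assume "i < dim_row (mat N N (\<lambda>(i, j). if P i j \<and> i \<noteq> j then \<Psi> $$ (f i div m, f j div m) else 0))"
    and "j < dim_col (mat N N (\<lambda>(i, j). if P i j \<and> i \<noteq> j then \<Psi> $$ (f i div m, f j div m) else 0))"
  then have ij: "i < N" "j < N" by auto
  have "f i = f j \<longleftrightarrow> i = j" using inj ij by (auto dest: inj_onD)
  then show "expected_mat M N (adj_sub A N f P) $$ (i, j) =
      mat N N (\<lambda>(i, j). if P i j \<and> i \<noteq> j then \<Psi> $$ (f i div m, f j div m) else 0) $$ (i, j)"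
    using ij range adj_expectation[of "f i" "f j"]
    by (cases "P i j"; cases "i = j") (auto simp: expected_mat_def adj_sub_entry)
qed (auto simp: expected_mat_def)

lemma adj_sub_random: "random_01_symmetric M N (adj_sub A N f P)"
  unfolding random_01_symmetric_def
proof (intro conjI ballI allI impI)
  fix \<omega> assume \<omega>: "\<omega> \<in> space M"
  show "adj_sub A N f P \<omega> \<in> carrier_mat N N" by (simp add: adj_sub_def)
  show "transpose_mat (adj_sub A N f P \<omega>) = adj_sub A N f P \<omega>"
    by (intro eq_matI) (auto simp: adj_sub_def P_sym adj_sym)
  show "adj_sub A N f P \<omega> $$ (i, j) \<in> {0, 1}" if "i < N" "j < N" for i j
    using adj_sub_zero_one[OF \<omega>] that by (simp add: zero_one_mats_def)
  show "adj_sub A N f P \<omega> $$ (i, i) = 0" if "i < N" for i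
    using that by (simp add: adj_sub_entry adj_def)
next
  let ?J = "{(i, j). j < i \<and> i < N}"
  define g where "g p = (f (fst p), f (snd p))" for p
  have inj_f: "f i = f j \<longleftrightarrow> i = j" if "i < N" "j < N" for i j
    using inj that by (auto dest: inj_onD)
  have inj_g: "inj_on g ?J"
    by (auto simp: inj_on_def g_def inj_f)
  have "indep_vars (\<lambda>_. borel) (\<lambda>p. adj A (fst p) (snd p)) (g ` ?J)"
    by (rule adj_indep) (auto simp: g_def inj_f range)
  from indep_vars_reindex[OF this inj_g subset_refl]
  have "indep_vars (\<lambda>_. borel) (\<lambda>p. adj A (f (fst p)) (f (snd p))) ?J"
    by (simp add: g_def)
  \<comment> \<open>Masking applies the identity or the zero function to each entry, which preserves
    independence.\<close>
  from indep_vars_compose2[OF this, where Y = "\<lambda>p x. if P (fst p) (snd p) then x else 0" and N = "\<lambda>_. borel"]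
  have *: "indep_vars (\<lambda>_. borel) (\<lambda>p \<omega>. if P (fst p) (snd p) then adj A (f (fst p)) (f (snd p)) \<omega> else 0) ?J"
    by simp
  have "(\<lambda>\<omega>. if P (fst p) (snd p) then adj A (f (fst p)) (f (snd p)) \<omega> else 0) =
      (\<lambda>(i, j) \<omega>. adj_sub A N f P \<omega> $$ (i, j)) p" if "p \<in> ?J" for p
    using that by (auto simp: adj_sub_entry)
  from indep_vars_cong[THEN iffD1, OF refl this refl *]
  show "indep_vars (\<lambda>_. borel) (\<lambda>(i, j) \<omega>. adj_sub A N f P \<omega> $$ (i, j)) ?J" .
qed (rule prob_space_axioms)

text \<open>A 0/1 variable equals its square, so its variance is at most its mean.\<close>

lemma adj_sub_variance:
  assumes "i < N" "j < N" "0 \<le> v" and v: "P i j \<Longrightarrow> \<Psi> $$ (f i div m, f j div m) \<le> v"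
  shows "variance (\<lambda>\<omega>. adj_sub A N f P \<omega> $$ (i, j)) \<le> v"
proof -
  let ?X = "\<lambda>\<omega>. adj_sub A N f P \<omega> $$ (i, j)"
  have 01: "?X \<omega> \<in> {0, 1}" if "\<omega> \<in> space M" for \<omega>
    using adj_sub_zero_one[OF that] assms(1,2) by (simp add: zero_one_mats_def)
  have "\<bar>?X \<omega>\<bar> \<le> 1" if "\<omega> \<in> space M" for \<omega>
    using 01[OF that] by auto
  then have int: "integrable M ?X"
    using adj_sub_measurable[OF assms(1,2)]
    by (intro integrable_const_bound[of _ 1]) (auto intro!: AE_I2)
  have sq: "(?X \<omega>)\<^sup>2 = ?X \<omega>" if "\<omega> \<in> space M" for \<omega>
    using 01[OF that] by auto
  have "expectation (\<lambda>\<omega>. (?X \<omega>)\<^sup>2) = expectation ?X"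
    using sq by (intro Bochner_Integration.integral_cong) auto
  moreover have "integrable M (\<lambda>\<omega>. (?X \<omega>)\<^sup>2)"
    using int sq by (simp cong: Bochner_Integration.integrable_cong)
  ultimately have "variance ?X \<le> expectation ?X"
    using int by (simp add: variance_eq)
  also have "expectation ?X = expected_mat M N (adj_sub A N f P) $$ (i, j)"
    using assms(1,2) by (simp add: expected_mat_def)
  also have "\<dots> \<le> v" unfolding adj_sub_expected using assms by auto
  finally show ?thesis .
qed

end

text \<open>The diagonal of A may take arbitrary real values, but the solution set depends only on
  the zero-diagonal adjacency matrix, which takes finitely many values.\<close>

lemma solution_event: "{\<omega> \<in> space M. Q (sdp1_solutions (m * K) K (A \<omega>))} \<in> events"
proof -
  let ?B = "adj_sub A (m * K) (\<lambda>i. i) (\<lambda>_ _. True)"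
  have "sdp1_solutions (m * K) K (A \<omega>) = sdp1_solutions (m * K) K (?B \<omega>)" if "\<omega> \<in> space M" for \<omega>
    using A_carrier[OF that] adj_eq[OF that]
    by (intro sdp1_solutions_cong_off_diagonal) (auto simp: adj_sub_def)
  then have "{\<omega> \<in> space M. Q (sdp1_solutions (m * K) K (A \<omega>))} =
      {\<omega> \<in> space M. Q (sdp1_solutions (m * K) K (?B \<omega>))}" by auto
  also have "\<dots> \<in> events"
    by (rule adj_sub_event[where Q = "\<lambda>X. Q (sdp1_solutions (m * K) K X)"]) auto
  finally show ?thesis .
qed

text \<open>Concentration with \<sigma> = sqrt v. Here v may exceed the actual variances, which
  leaves room to meet the sparsity condition.\<close>

lemma norm_tail:
  assumes cc: "concentration_constants C C' c r" and N: "1 \<le> N"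
    and range: "\<And>i. i < N \<Longrightarrow> f i < m * K" and inj: "inj_on f {..<N}" and P_sym: "\<And>i j. P i j = P j i"
    and v0: "0 \<le> v" and v: "\<And>i j. i < N \<Longrightarrow> j < N \<Longrightarrow> P i j \<Longrightarrow> \<Psi> $$ (f i div m, f j div m) \<le> v"
    and sparse: "C' * ln (real N) \<le> real N * v"
  shows "prob {\<omega> \<in> space M. \<not> operator_norm (adj_sub A N f P \<omega> - expected_mat M N (adj_sub A N f P))
      \<le> C * sqrt (real N * v)} \<le> c * real N powr (- r)"
proof -
  have "1 - c * real N powr (- r) \<le> prob {\<omega> \<in> space M.
      operator_norm (adj_sub A N f P \<omega> - expected_mat M N (adj_sub A N f P)) \<le> C * sqrt v * sqrt (real N)}"
  proof (rule concentration_general[OF cc N adj_sub_random[OF range inj P_sym]])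
    show "variance (\<lambda>\<omega>. adj_sub A N f P \<omega> $$ (i, j)) \<le> (sqrt v)\<^sup>2" if "i < N" "j < N" for i j
      using adj_sub_variance[OF range inj P_sym that v0 v[OF that]] v0 by simp
  qed (use adj_sub_measurable[OF range inj P_sym] v0 sparse in auto)
  moreover have "C * sqrt v * sqrt (real N) = C * sqrt (real N * v)"
    by (simp add: real_sqrt_mult)
  ultimately show ?thesis
    using prob_neg[OF adj_sub_event[OF range inj P_sym, of "\<lambda>X. operator_norm (X - expected_mat M N (adj_sub A N f P)) \<le> C * sqrt (real N * v)"]]
    by simp
qed

lemma quad_form_le_norm:
  assumes range: "\<And>i. i < N \<Longrightarrow> f i < m * K" and inj: "inj_on f {..<N}" and P_sym: "\<And>i j. P i j = P j i"
    and le: "operator_norm (adj_sub A N f P \<omega> - expected_mat M N (adj_sub A N f P)) \<le> t"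
    and z: "\<And>i j. i < N \<Longrightarrow> j < N \<Longrightarrow> z i j = (if P i j then adj A (f i) (f j) \<omega>
      - (if i = j then 0 else \<Psi> $$ (f i div m, f j div m)) else 0)"
  shows "quad_form {..<N} z u \<le> t * (\<Sum>i<N. (u i)\<^sup>2)"
proof -
  let ?E = "expected_mat M N (adj_sub A N f P)"
  let ?D = "adj_sub A N f P \<omega> - ?E"
  have "quad_form {..<N} z u = quad_form {..<N} (\<lambda>i j. ?D $$ (i, j)) u"
    unfolding quad_form_def
    by (intro sum.cong refl) (auto simp: z adj_sub_expected[OF range inj P_sym] adj_sub_def adj_def)
  also have "\<dots> \<le> operator_norm ?D * (\<Sum>i<N. (u i)\<^sup>2)"
    by (rule quad_form_le_operator_norm) (simp add: adj_sub_def expected_mat_def minus_carrier_mat)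
  also have "\<dots> \<le> t * (\<Sum>i<N. (u i)\<^sup>2)"
    using le by (intro mult_right_mono sum_nonneg) auto
  finally show ?thesis .
qed

text \<open>Inner degrees, outer degrees and block totals are all sums over a set of edges, each in
  one orientation, with a common mean.\<close>

context
  fixes J :: "(nat \<times> nat) set" and q T :: real
  assumes J: "\<And>i j. (i, j) \<in> J \<Longrightarrow> i < m * K \<and> j < m * K \<and> i \<noteq> j \<and> (j, i) \<notin> J"
    and q: "\<And>i j. (i, j) \<in> J \<Longrightarrow> \<Psi> $$ (i div m, j div m) = q"
    and q0: "0 \<le> q" and T0: "0 \<le> T"
begin

lemma pairs_finite: "finite J"
  using J by (intro finite_subset[of J "{..<m * K} \<times> {..<m * K}"]) auto

lemma pairs_facts:
  assumes "p \<in> J"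
  shows "\<omega> \<in> space M \<Longrightarrow> adj A (fst p) (snd p) \<omega> \<in> {0, 1}"
    and "expectation (adj A (fst p) (snd p)) = q"
    and "adj A (fst p) (snd p) \<in> borel_measurable M"
proof -
  obtain i j where p: "p = (i, j)" "(i, j) \<in> J" using assms by (cases p) auto
  then have ij: "i < m * K" "j < m * K" "i \<noteq> j" using J by blast+
  show "\<omega> \<in> space M \<Longrightarrow> adj A (fst p) (snd p) \<omega> \<in> {0, 1}" using adj_01 ij p by simp
  show "expectation (adj A (fst p) (snd p)) = q" using adj_expectation[of i j] ij p q by simp
  show "adj A (fst p) (snd p) \<in> borel_measurable M" using adj_measurable ij p by simp
qed

lemma pairs_sum_measurable: "(\<lambda>\<omega>. \<Sum>p\<in>J. adj A (fst p) (snd p) \<omega>) \<in> borel_measurable M"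
  using pairs_facts(3) by (intro borel_measurable_sum) auto

lemma pairs_lower_tail:
  "prob {\<omega> \<in> space M. (\<Sum>p\<in>J. adj A (fst p) (snd p) \<omega>) < real (card J) * q - sqrt (2 * (real (card J) * q) * T)}
    \<le> exp (- T)"
  by (rule bernoulli_sum_lower_tail[OF pairs_finite adj_indep[OF J] pairs_facts(1,2) q0 T0])

lemma pairs_upper_tail:
  "prob {\<omega> \<in> space M. real (card J) * q + 2 * sqrt (real (card J) * q * T) + T < (\<Sum>p\<in>J. adj A (fst p) (snd p) \<omega>)}
    \<le> exp (- T)"
  by (rule bernoulli_sum_upper_tail[OF pairs_finite adj_indep[OF J] pairs_facts(1,2) q0 T0])

end

section \<open>From good events to the certificate\<close>

text \<open>With U k = 2 m \<mu>_k, the balance condition becomes a lower bound on inner degrees,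
  and \<open>outer\<close> is m times the slack.\<close>

lemma block_certificate_intro:
  fixes U s :: "nat \<Rightarrow> real" and t :: real and \<omega> :: 'a
  defines "a \<equiv> \<lambda>i j. adj A i j \<omega>" and "S \<equiv> \<lambda>k. {i. i < m * K \<and> i div m = k}"
  assumes m: "1 \<le> m"
    and blocks: "\<And>k v. k < K \<Longrightarrow> quad_form {..<m} (\<lambda>i j. a (k * m + i) (k * m + j)
        - (if k * m + i = k * m + j then 0 else \<Psi> $$ ((k * m + i) div m, (k * m + j) div m))) v
        \<le> s k * (\<Sum>i<m. (v i)\<^sup>2)"
    and off: "\<And>v. quad_form {..<m * K} (\<lambda>i j. if i div m = j div m then 0 else
        a i j - (if i = j then 0 else \<Psi> $$ (i div m, j div m))) v \<le> t * (\<Sum>i<m * K. (v i)\<^sup>2)"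
    and inner: "\<And>i. i < m * K \<Longrightarrow>
        U (i div m) + s (i div m) + t - \<Psi> $$ (i div m, i div m) \<le> (\<Sum>j\<in>S (i div m). a i j)"
    and outer: "\<And>i j. i < m * K \<Longrightarrow> j < m * K \<Longrightarrow> i div m \<noteq> j div m \<Longrightarrow>
        0 < U (i div m) / 2 + U (j div m) / 2 - (\<Sum>l\<in>S (j div m). a i l) - (\<Sum>l\<in>S (i div m). a j l)
          + (\<Sum>i'\<in>S (i div m). \<Sum>j'\<in>S (j div m). a i' j') / real m"
  shows "block_certificate {..<m * K} (\<lambda>i. i div m) a (real m) (\<lambda>k. U k / (2 * real m))"
proof
  have S: "{j \<in> {..<m * K}. j div m = k} = S k" for k by (auto simp: S_def)
  have deg: "block_degree {..<m * K} (\<lambda>i. i div m) a i k = (\<Sum>j\<in>S k. a i j)" for i k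
    unfolding block_degree_def S ..
  have tot: "block_total {..<m * K} (\<lambda>i. i div m) a k l = (\<Sum>i\<in>S k. \<Sum>j\<in>S l. a i j)" for k l
    unfolding block_total_def deg S ..
  show "finite {..<m * K}" by simp
  show "real (card {j \<in> {..<m * K}. j div m = i div m}) = real m" if "i \<in> {..<m * K}" for i
    using that card_block_nat[OF div_block_less, of i m K] by (simp add: S S_def)
  show "a i j = a j i" for i j unfolding a_def by (rule adj_sym)
  show "0 < dual_slack {..<m * K} (\<lambda>i. i div m) a (real m) (\<lambda>k. U k / (2 * real m)) i j"
    if "i \<in> {..<m * K}" "j \<in> {..<m * K}" "i div m \<noteq> j div m" for i j
  proof -
    have "dual_slack {..<m * K} (\<lambda>i. i div m) a (real m) (\<lambda>k. U k / (2 * real m)) i j =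
      (U (i div m) / 2 + U (j div m) / 2 - (\<Sum>l\<in>S (j div m). a i l) - (\<Sum>l\<in>S (i div m). a j l)
          + (\<Sum>i'\<in>S (i div m). \<Sum>j'\<in>S (j div m). a i' j') / real m) / real m"
      using that(3) m unfolding dual_slack_def deg tot by (simp add: field_simps power2_eq_square)
    then show ?thesis using outer[of i j] that m by simp
  qed
  fix u :: "nat \<Rightarrow> real"
  assume u: "\<And>l. (\<Sum>i | i \<in> {..<m * K} \<and> i div m = l. u i) = 0"
  have "quad_form {..<m * K} a u \<le>
      (\<Sum>i<m * K. (s (i div m) + t - \<Psi> $$ (i div m, i div m)) * (u i)\<^sup>2)"
    using balanced_quad_form_bound[where P = "\<lambda>k l. \<Psi> $$ (k, l)", OF blocks off u] .
  also have "\<dots> \<le> (\<Sum>i<m * K. (block_degree {..<m * K} (\<lambda>i. i div m) a i (i div m)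
      - 2 * real m * (U (i div m) / (2 * real m))) * (u i)\<^sup>2)"
  proof (intro sum_mono mult_right_mono)
    fix i assume "i \<in> {..<m * K}"
    then show "s (i div m) + t - \<Psi> $$ (i div m, i div m) \<le>
      block_degree {..<m * K} (\<lambda>i. i div m) a i (i div m) - 2 * real m * (U (i div m) / (2 * real m))"
      using inner[of i] m unfolding deg by simp
  qed simp
  finally show "quad_form {..<m * K} a u \<le> (\<Sum>i<m * K. (block_degree {..<m * K} (\<lambda>i. i div m) a i (i div m)
      - 2 * real m * (U (i div m) / (2 * real m))) * (u i)\<^sup>2)" .
qed

lemma strong_consistency:
  fixes n :: nat and C C' c r c1 c2 C2 qm L :: real and x y :: "nat \<Rightarrow> real"
  assumes cc: "concentration_constants C C' c r"
    and m: "1 \<le> m" and K: "2 \<le> K" and n: "n = m * K" and L: "L = ln (real n)"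
    and c1: "0 < c1" and c2: "0 < c2"
    and C2a: "sqrt (4 * (c1 + 1)) + C \<le> C2" and C2b: "6 * sqrt (2 * (c2 + 1)) \<le> C2"
    and y: "\<And>k. k < K \<Longrightarrow> y k = real m * \<Psi> $$ (k, k)"
    and x0: "\<And>k. k < K \<Longrightarrow> 0 \<le> x k"
    and x: "\<And>k l. k < K \<Longrightarrow> l < K \<Longrightarrow> k \<noteq> l \<Longrightarrow> real m * \<Psi> $$ (k, l) \<le> x k"
    and qm0: "0 \<le> qm" and qm: "\<And>k l. k < K \<Longrightarrow> l < K \<Longrightarrow> k \<noteq> l \<Longrightarrow> \<Psi> $$ (k, l) \<le> qm"
    and C'y: "\<And>k. k < K \<Longrightarrow> C' * L \<le> y k"
    and gap: "\<And>k. k < K \<Longrightarrow>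
      C * sqrt (real n * qm) < y k - x k - C2 * (sqrt (y k * L) + sqrt (x k * L))"
  shows "prob {\<omega> \<in> space M. sdp1_solutions n K (A \<omega>) = {true_cluster_mat m K}}
          \<ge> 1 - c * (real K * real m powr (- r) + real n powr (- r))
              - real n powr (- c1) - 2 * inverse (real m) * real n powr (- c2)"
proof -
  have const: "0 < C" "0 < C'" "0 < c" using cc by (auto simp: concentration_constants_def)
  have n0: "0 < n" "m \<le> n" using m K n by auto
  have C20: "0 < C2"
  proof -
    have "0 < sqrt (2 * (c2 + 1))" using c2 by simp
    then show ?thesis using C2b by linarith
  qed
  have y0: "0 \<le> y k" if "k < K" for k using psi_bounds(1)[of k k] that y by simp
  have R0: "0 \<le> C * sqrt (real n * qm)" using const qm0 by simp
  \<comment> \<open>A single block suffices, here block 0: its gap gives C2^2 L <= m p_0, and C2^2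
    is at least 72.\<close>
  have L6: "6 \<le> L"
  proof -
    have k: "0 < K" using K by simp
    have "0 \<le> L" using n0 unfolding L by (intro ln_ge_zero) simp
    then have "C2\<^sup>2 * L \<le> y 0"
      using gap_imp_degree_bound[OF _ y0[OF k] x0[OF k] C20 R0 gap[OF k]] by simp
    moreover have "72 \<le> C2\<^sup>2" using square_constant_bound[OF c2 C2b] c2 by simp
    ultimately show ?thesis
      using block_size_log_bound[OF n K m psi_bounds(2)[OF k k]] y[OF k] L by simp
  qed
  define S where "S k = {i. i < m * K \<and> i div m = k}" for k
  have finS: "finite (S k)" for k by (simp add: S_def)
  have cardS: "card (S k) = m" if "k < K" for k unfolding S_def by (rule card_block_nat[OF that])
  \<comment> \<open>Below \<open>C' L / n\<close> the variance bound is raised to keep the sparsity hypothesis.\<close>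
  define v where "v = max qm (C' * L / real n)"
  define t where "t = C * sqrt (real n * v)"
  have nv: "real n * v = max (real n * qm) (C' * L)"
    using n0 unfolding v_def by (simp add: max_mult_distrib_left)
  have v0: "0 \<le> v" using qm0 by (simp add: v_def)
  have t: "t \<le> C * sqrt (real n * qm) + C * sqrt (C' * L)"
  proof -
    have "0 \<le> real n * qm" "0 \<le> C' * L" using qm0 const L6 by simp_all
    then have "sqrt (max (real n * qm) (C' * L)) \<le> sqrt (real n * qm) + sqrt (C' * L)"
      by (simp add: max_def)
    from mult_left_mono[OF this, of C] show ?thesis
      using const by (simp add: t_def nv distrib_left)
  qed
  \<comment> \<open>T1 pays for a union over n vertices and leaves n^(-c1). T2 pays for n K pairs of
    a vertex and a block: n K / n^2 = 1 / m.\<close>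
  define T1 T2 where "T1 = (c1 + 1) * L" and "T2 = (c2 + 2) * L"
  have T0: "0 \<le> T1" "0 \<le> T2" using c1 c2 L6 by (simp_all add: T1_def T2_def)
  \<comment> \<open>The largest value permitted by the lower tail of the inner degrees after both
    norm bounds are subtracted.\<close>
  define U where "U k = y k - sqrt (2 * y k * T1) - C * sqrt (y k) - t" for k
  have U: "real m * \<Psi> $$ (k, l) + C2 * sqrt (real m * \<Psi> $$ (k, l) * L) + 12 * (c2 + 1) * L < U k"
    if kl: "k < K" "l < K" "k \<noteq> l" for k l
  proof -
    have "x k + C2 * sqrt (x k * L) + 12 * (c2 + 1) * L < U k"
      unfolding U_def T1_def
      by (rule dual_margin[OF L6 y0[OF kl(1)] x0[OF kl(1)] const(1) c1 c2 R0 C2a C2b gap[OF kl(1)] C'y[OF kl(1)] t])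
    moreover have "C2 * sqrt (real m * \<Psi> $$ (k, l) * L) \<le> C2 * sqrt (x k * L)"
      using x[OF kl] C20 L6 by (intro mult_left_mono real_sqrt_le_mono mult_right_mono) auto
    ultimately show ?thesis using x[OF kl] by linarith
  qed

  let ?P1 = "\<lambda>(_::nat) (_::nat). True" and ?P2 = "\<lambda>i j. i div m \<noteq> j div m"
  let ?f = "\<lambda>k i::nat. k * m + i"
  \<comment> \<open>The five kinds of bad events: B1 for the norms of the diagonal blocks, B2 for
    the norm of the part between blocks, B3 for inner degrees, B4 for outer degrees, B5 for block
    totals.\<close>
  define B1 where "B1 k = {\<omega> \<in> space M. \<not> operator_norm
      (adj_sub A m (?f k) ?P1 \<omega> - expected_mat M m (adj_sub A m (?f k) ?P1)) \<le> C * sqrt (real m * \<Psi> $$ (k, k))}" for k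
  define B2 where "B2 = {\<omega> \<in> space M. \<not> operator_norm
      (adj_sub A n (\<lambda>i. i) ?P2 \<omega> - expected_mat M n (adj_sub A n (\<lambda>i. i) ?P2)) \<le> C * sqrt (real n * v)}"
  define low where "low J q T = {\<omega> \<in> space M. (\<Sum>p\<in>J. adj A (fst p) (snd p) \<omega>)
      < real (card J) * q - sqrt (2 * (real (card J) * q) * T)}" for J q T
  define up where "up J q T = {\<omega> \<in> space M. real (card J) * q + 2 * sqrt (real (card J) * q * T) + T
      < (\<Sum>p\<in>J. adj A (fst p) (snd p) \<omega>)}" for J q T
  define B3 where "B3 i = low ({i} \<times> (S (i div m) - {i})) (\<Psi> $$ (i div m, i div m)) T1" for i
  define B4 where "B4 p = up ({fst p} \<times> S (snd p)) (\<Psi> $$ (fst p div m, snd p)) T2" for p :: "nat \<times> nat"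
  define B5 where "B5 p = low (S (fst p) \<times> S (snd p)) (\<Psi> $$ p) T2" for p
  define I4 where "I4 = {(i, l). i < n \<and> l < K \<and> l \<noteq> i div m}"
  define I5 where "I5 = {(k, l). k < K \<and> l < K \<and> k \<noteq> l}"
  have sub4: "I4 \<subseteq> {..<n} \<times> {..<K}" and sub5: "I5 \<subseteq> {..<K} \<times> {..<K}" by (auto simp: I4_def I5_def)
  have fin4: "finite I4" "card I4 \<le> n * K"
    using finite_subset[OF sub4] card_mono[OF _ sub4] by simp_all
  have fin5: "finite I5" "card I5 \<le> K * K"
    using finite_subset[OF sub5] card_mono[OF _ sub5] by simp_all

  have f_range: "?f k i < m * K" and f_div: "(?f k i) div m = k" if "k < K" "i < m" for k i
    using block_eq_interval[OF that(1), of m] that(2) by blast+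
  have f_inj: "inj_on (?f k) {..<m}" for k by (simp add: inj_on_def)

  have B1: "prob (B1 k) \<le> c * real m powr (- r)" "B1 k \<in> events" if k: "k < K" for k
  proof -
    have "C' * ln (real m) \<le> C' * L"
      using const m n0 unfolding L by (intro mult_left_mono ln_mono) auto
    also have "\<dots> \<le> real m * \<Psi> $$ (k, k)" using C'y[OF k] y[OF k] by simp
    finally show "prob (B1 k) \<le> c * real m powr (- r)"
      unfolding B1_def using f_range[OF k] f_inj psi_bounds(1)[OF k k] f_div[OF k]
      by (intro norm_tail[OF cc m]) auto
    show "B1 k \<in> events"
      unfolding B1_def using f_range[OF k] f_inj
      by (intro adj_sub_event[where Q = "\<lambda>X. \<not> operator_norm (X - expected_mat M m (adj_sub A m (?f k) ?P1))
        \<le> C * sqrt (real m * \<Psi> $$ (k, k))"]) auto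
  qed
  have B2: "prob B2 \<le> c * real n powr (- r)" "B2 \<in> events"
  proof -
    show "prob B2 \<le> c * real n powr (- r)"
      unfolding B2_def
    proof (rule norm_tail[OF cc])
      fix i j assume "i < n" "j < n" "?P2 i j"
      then show "\<Psi> $$ (i div m, j div m) \<le> v"
        using qm[of "i div m" "j div m"] n by (simp add: v_def div_block_less le_max_iff_disj)
    qed (use n0 n v0 nv L in auto)
    show "B2 \<in> events"
      unfolding B2_def using n
      by (intro adj_sub_event[where Q = "\<lambda>X. \<not> operator_norm (X - expected_mat M n (adj_sub A n (\<lambda>i. i) ?P2))
        \<le> C * sqrt (real n * v)"]) auto
  qed
  have low: "prob (low J q T) \<le> exp (- T)" "low J q T \<in> events"
    and up: "prob (up J q T) \<le> exp (- T)" "up J q T \<in> events"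
    if "\<And>i j. (i, j) \<in> J \<Longrightarrow> i < m * K \<and> j < m * K \<and> i \<noteq> j \<and> (j, i) \<notin> J"
      "\<And>i j. (i, j) \<in> J \<Longrightarrow> \<Psi> $$ (i div m, j div m) = q" "0 \<le> q" "0 \<le> T" for J q T
  proof -
    note meas[measurable] = pairs_sum_measurable[OF that]
    show "prob (low J q T) \<le> exp (- T)" unfolding low_def by (rule pairs_lower_tail[OF that])
    show "prob (up J q T) \<le> exp (- T)" unfolding up_def by (rule pairs_upper_tail[OF that])
    show "low J q T \<in> events" "up J q T \<in> events" unfolding low_def up_def by measurable
  qed
  have B3: "prob (B3 i) \<le> exp (- T1)" "B3 i \<in> events" if "i < n" for i
    unfolding B3_def using that n T0 psi_bounds(1)
    by (intro low; auto simp: S_def div_block_less)+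
  have B4: "prob (B4 p) \<le> exp (- T2)" "B4 p \<in> events" if "p \<in> I4" for p
    unfolding B4_def using that n T0 psi_bounds(1)
    by (intro up; auto simp: S_def I4_def div_block_less)+
  have B5: "prob (B5 p) \<le> exp (- T2)" "B5 p \<in> events" if "p \<in> I5" for p
    unfolding B5_def using that n T0 psi_bounds(1)
    by (intro low; auto simp: S_def I5_def div_block_less)+

  define Bad where "Bad = (\<Union>k<K. B1 k) \<union> B2 \<union> (\<Union>i<n. B3 i) \<union> (\<Union>p\<in>I4. B4 p) \<union> (\<Union>p\<in>I5. B5 p)"
  have ev1: "(\<Union>k<K. B1 k) \<in> events" using B1(2) by (intro sets.finite_UN) auto
  have ev3: "(\<Union>i<n. B3 i) \<in> events" using B3(2) by (intro sets.finite_UN) auto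
  have ev4: "(\<Union>p\<in>I4. B4 p) \<in> events" using B4(2) fin4 by (intro sets.finite_UN) auto
  have ev5: "(\<Union>p\<in>I5. B5 p) \<in> events" using B5(2) fin5 by (intro sets.finite_UN) auto
  have Bad_event: "Bad \<in> events" unfolding Bad_def using ev1 B2(2) ev3 ev4 ev5 by auto
  have expT: "exp (- (e * L)) = real n powr (- e)" for e
    using n0 by (simp add: powr_def L)
  have e1: "real n * exp (- T1) = real n powr (- c1)"
    unfolding T1_def expT using n0 powr_add[of "real n" 1 "- (c1 + 1)"] by simp
  have e2: "exp (- T2) = real n powr (- c2) / (real n * real n)"
    unfolding T2_def expT using n0 powr_add[of "real n" "- c2" "- 2"]
    by (simp add: powr_minus divide_inverse power2_eq_square powr_numeral)
  have e4: "real (n * K) * exp (- T2) = inverse (real m) * real n powr (- c2)"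
    unfolding e2 using n0 m K by (simp add: n field_simps)
  \<comment> \<open>As K <= n, the pairs of blocks cost no more than the pairs of a vertex and a
    block; the two unions account for the factor 2 in the bound.\<close>
  have e5: "real (K * K) * exp (- T2) \<le> inverse (real m) * real n powr (- c2)"
  proof -
    have "K * K \<le> n * K" using n m by simp
    then have "real (K * K) \<le> real (n * K)" by (simp only: of_nat_le_iff)
    then have "real (K * K) * exp (- T2) \<le> real (n * K) * exp (- T2)" by (intro mult_right_mono) auto
    then show ?thesis unfolding e4 .
  qed
  have "prob Bad \<le> prob (\<Union>k<K. B1 k) + prob B2 + prob (\<Union>i<n. B3 i) + prob (\<Union>p\<in>I4. B4 p) + prob (\<Union>p\<in>I5. B5 p)"
    unfolding Bad_def using ev1 B2(2) ev3 ev4 ev5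
    by (intro order_trans[OF measure_Un_le] add_mono order_refl) auto
  also have "\<dots> \<le> real K * (c * real m powr (- r)) + c * real n powr (- r) + real n * exp (- T1)
      + real (n * K) * exp (- T2) + real (K * K) * exp (- T2)"
    using B1 B2 B3 B4 B5 const fin4 fin5
    by (intro add_mono prob_UN_le) (auto simp del: of_nat_mult)
  also have "\<dots> \<le> c * (real K * real m powr (- r) + real n powr (- r)) + real n powr (- c1)
      + 2 * inverse (real m) * real n powr (- c2)"
    using e1 e4 e5 by (simp add: algebra_simps)
  finally have prob_Bad: "prob Bad \<le> c * (real K * real m powr (- r) + real n powr (- r)) + real n powr (- c1)
      + 2 * inverse (real m) * real n powr (- c2)" .

  have good: "sdp1_solutions n K (A \<omega>) = {true_cluster_mat m K}" if \<omega>: "\<omega> \<in> space M" "\<omega> \<notin> Bad" for \<omega>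
    unfolding n
  proof (rule sdp1_unique_solution)
    show "0 < K" using K by simp
    show "A \<omega> \<in> carrier_mat (m * K) (m * K)" by (rule A_carrier[OF \<omega>(1)])
    show "adj A i j \<omega> = (if i = j then 0 else A \<omega> $$ (i, j))" if "i < m * K" "j < m * K" for i j
      by (rule adj_eq[OF \<omega>(1) that])
    have row_sum: "(\<Sum>p\<in>{i} \<times> Y. adj A (fst p) (snd p) \<omega>) = (\<Sum>j\<in>Y. adj A i j \<omega>)" for i Y
      using sum.cartesian_product[of "\<lambda>i j. adj A i j \<omega>" Y "{i}"] by (simp add: case_prod_unfold)
    have deg_up: "(\<Sum>j\<in>S l. adj A i j \<omega>) \<le> real m * \<Psi> $$ (i div m, l)
        + 2 * sqrt (real m * \<Psi> $$ (i div m, l) * T2) + T2" if "i < n" "l < K" "l \<noteq> i div m" for i l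
    proof -
      have "\<omega> \<notin> B4 (i, l)" using \<omega>(2) that by (auto simp: Bad_def I4_def)
      then show ?thesis using \<omega>(1) cardS[OF that(2)]
        by (simp add: B4_def up_def row_sum card_cartesian_product not_less)
    qed
    show "block_certificate {..<m * K} (\<lambda>i. i div m) (\<lambda>i j. adj A i j \<omega>) (real m) (\<lambda>k. U k / (2 * real m))"
    proof (rule block_certificate_intro[where s = "\<lambda>k. C * sqrt (y k)" and t = t, OF m])
      fix k u assume k: "k < K"
      have "\<omega> \<notin> B1 k" using \<omega>(2) k by (auto simp: Bad_def)
      then have "operator_norm (adj_sub A m (?f k) ?P1 \<omega> - expected_mat M m (adj_sub A m (?f k) ?P1)) \<le> C * sqrt (y k)"
        using \<omega>(1) y[OF k] by (simp add: B1_def)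
      then show "quad_form {..<m} (\<lambda>i j. adj A (k * m + i) (k * m + j) \<omega>
        - (if k * m + i = k * m + j then 0 else \<Psi> $$ ((k * m + i) div m, (k * m + j) div m))) u
        \<le> C * sqrt (y k) * (\<Sum>i<m. (u i)\<^sup>2)"
        using f_range[OF k] f_inj by (intro quad_form_le_norm[where f = "?f k" and P = ?P1]) auto
    next
      fix u
      have "\<omega> \<notin> B2" using \<omega>(2) by (auto simp: Bad_def)
      then have "operator_norm (adj_sub A n (\<lambda>i. i) ?P2 \<omega> - expected_mat M n (adj_sub A n (\<lambda>i. i) ?P2)) \<le> t"
        using \<omega>(1) by (simp add: B2_def t_def)
      then show "quad_form {..<m * K} (\<lambda>i j. if i div m = j div m then 0 else
        adj A i j \<omega> - (if i = j then 0 else \<Psi> $$ (i div m, j div m))) u \<le> t * (\<Sum>i<m * K. (u i)\<^sup>2)"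
        unfolding n by (intro quad_form_le_norm[where f = "\<lambda>i. i" and P = ?P2]) auto
    next
      fix i assume i: "i < m * K"
      define k where "k = i div m"
      have k: "k < K" using i by (simp add: k_def div_block_less)
      have iS: "i \<in> S k" using i by (simp add: S_def k_def)
      have card: "real (card (S k - {i})) = real m - 1"
        using cardS[OF k] finS[of k] iS m by (simp add: card_Diff_singleton of_nat_diff)
      have "\<omega> \<notin> B3 i" using \<omega>(2) i n by (auto simp: Bad_def)
      then have "(real m - 1) * \<Psi> $$ (k, k) - sqrt (2 * ((real m - 1) * \<Psi> $$ (k, k)) * T1)
          \<le> (\<Sum>j\<in>S k - {i}. adj A i j \<omega>)"
        using \<omega>(1) card by (simp add: B3_def low_def row_sum card_cartesian_product k_def[symmetric] not_less)
      also have "\<dots> = (\<Sum>j\<in>S k. adj A i j \<omega>)"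
        using finS[of k] iS by (simp add: sum.remove[of _ i] adj_def)
      finally have 1: "(real m - 1) * \<Psi> $$ (k, k) - sqrt (2 * ((real m - 1) * \<Psi> $$ (k, k)) * T1)
          \<le> (\<Sum>j\<in>S k. adj A i j \<omega>)" .
      \<comment> \<open>A vertex has only m - 1 possible neighbours in its block. The missing p_k is
        exactly the correction - P k k that the zero diagonal leaves in the balance
        condition.\<close>
      have eq: "(real m - 1) * \<Psi> $$ (k, k) = y k - \<Psi> $$ (k, k)" by (simp add: y[OF k] algebra_simps)
      have "sqrt (2 * (y k - \<Psi> $$ (k, k)) * T1) \<le> sqrt (2 * y k * T1)"
        using psi_bounds(1)[OF k k] T0 by (intro real_sqrt_le_mono mult_right_mono) auto
      then have "U k + C * sqrt (y k) + t - \<Psi> $$ (k, k) \<le> (\<Sum>j\<in>S k. adj A i j \<omega>)"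
        using 1 unfolding eq U_def by linarith
      then show "U (i div m) + C * sqrt (y (i div m)) + t - \<Psi> $$ (i div m, i div m)
        \<le> (\<Sum>j | j < m * K \<and> j div m = i div m. adj A i j \<omega>)"
        by (simp add: k_def S_def)
    next
      fix i j assume ij: "i < m * K" "j < m * K" "i div m \<noteq> j div m"
      define k l where "k = i div m" and "l = j div m"
      have kl: "k < K" "l < K" "k \<noteq> l" using ij by (auto simp: k_def l_def div_block_less)
      define z where "z = real m * \<Psi> $$ (k, l)"
      have z0: "0 \<le> z" using psi_bounds(1)[OF kl(1,2)] by (simp add: z_def)
      define e where "e = (\<Sum>i'\<in>S k. \<Sum>j'\<in>S l. adj A i' j' \<omega>)"
      have "\<omega> \<notin> B5 (k, l)" using \<omega>(2) kl by (auto simp: Bad_def I5_def)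
      moreover have "(\<Sum>p\<in>S k \<times> S l. adj A (fst p) (snd p) \<omega>) = e"
        unfolding e_def by (simp add: sum.cartesian_product case_prod_unfold)
      ultimately have "real m * z - sqrt (2 * (real m * z) * T2) \<le> e"
        using \<omega>(1) cardS kl
        by (simp add: B5_def low_def card_cartesian_product not_less z_def mult.assoc)
      \<comment> \<open>The crude bound sqrt m <= m suffices: after division by m, the block total
        may deviate as much as a single row.\<close>
      moreover have "sqrt (2 * (real m * z) * T2) \<le> real m * sqrt (2 * z * T2)"
      proof -
        have "0 \<le> 2 * z * T2" using z0 T0 by simp
        then have "real m * (2 * z * T2) \<le> real m * real m * (2 * z * T2)"
          using m by (intro mult_right_mono) auto
        then have "sqrt (2 * (real m * z) * T2) \<le> sqrt (real m * real m * (2 * z * T2))"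
          by (intro real_sqrt_le_mono) (simp add: mult_ac)
        also have "\<dots> = real m * sqrt (2 * z * T2)"
          unfolding real_sqrt_mult[of "real m * real m"] by simp
        finally show ?thesis .
      qed
      ultimately have "real m * (z - sqrt (2 * z * T2)) \<le> e" by (simp add: right_diff_distrib)
      then have e: "z - sqrt (2 * z * T2) \<le> e / real m"
        using m by (simp add: pos_le_divide_eq mult.commute)
      have z': "real m * \<Psi> $$ (l, k) = z" using psi_sym[OF kl(1,2)] by (simp add: z_def)
      have d1: "(\<Sum>j'\<in>S l. adj A i j' \<omega>) \<le> z + 2 * sqrt (z * T2) + T2"
        using deg_up[of i l] ij kl n by (simp add: z_def k_def)
      have d2: "(\<Sum>i'\<in>S k. adj A j i' \<omega>) \<le> z + 2 * sqrt (z * T2) + T2"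
        using deg_up[of j k] ij kl n z' by (simp add: l_def)
      have "0 < U k / 2 + U l / 2 - (\<Sum>j'\<in>S l. adj A i j' \<omega>) - (\<Sum>i'\<in>S k. adj A j i' \<omega>) + e / real m"
        using U[OF kl] U[of l k] kl z' L6
        by (intro slack_margin[OF z0 _ c2 C2b T2_def _ _ d1 d2 e]) (auto simp: z_def)
      then show "0 < U (i div m) / 2 + U (j div m) / 2
          - (\<Sum>l | l < m * K \<and> l div m = j div m. adj A i l \<omega>)
          - (\<Sum>l | l < m * K \<and> l div m = i div m. adj A j l \<omega>)
          + (\<Sum>i' | i' < m * K \<and> i' div m = i div m. \<Sum>j' | j' < m * K \<and> j' div m = j div m. adj A i' j' \<omega>) / real m"
        by (simp add: e_def S_def k_def l_def)
    qed
  qed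
  have "1 - prob Bad = prob (space M - Bad)" by (rule prob_compl[symmetric, OF Bad_event])
  also have "\<dots> \<le> prob {\<omega> \<in> space M. sdp1_solutions n K (A \<omega>) = {true_cluster_mat m K}}"
    using good solution_event[of "\<lambda>X. X = {true_cluster_mat m K}"] unfolding n
    by (intro finite_measure_mono) auto
  finally show ?thesis using prob_Bad by linarith
qed

end

section \<open>From scaled to unscaled parameters\<close>

theorem theorem4p2:
  fixes M :: "'a measure" and A :: "'a \<Rightarrow> real mat" and \<Psi> :: "real mat"
    and m K n :: nat and C C' c r c\<^sub>1 c\<^sub>2 C\<^sub>1 C\<^sub>2 :: real
  assumes "concentration_constants C C' c r"
    and "m \<ge> 1" and "K \<ge> 2" and "n = m * K"
    and "BM_bal M m K \<Psi> A" and "weakly_assortative \<Psi>"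
    and "c\<^sub>1 > 0" and "c\<^sub>2 > 0"
    and "C\<^sub>1 = max C' (4 / 9 * (c\<^sub>1 + 1))"
    and "C\<^sub>2 = max (sqrt (4 * (c\<^sub>1 + 1)) + C) (6 * sqrt (2 * (c\<^sub>2 + 1)))"
    and "(MIN k \<in> {..<K}. scaled m n (p_in \<Psi> k)) \<ge> C\<^sub>1"
    and "(MIN k \<in> {..<K}. (scaled m n (p_in \<Psi> k) - scaled m n (q_star \<Psi> k))
            - C\<^sub>2 * (sqrt (scaled m n (p_in \<Psi> k)) + sqrt (scaled m n (q_star \<Psi> k))))
          > C * sqrt (scaled m n (q_star_max \<Psi>) * real K / ln (real n))"
  shows "prob_space.prob M {\<omega> \<in> space M. sdp1_solutions n K (A \<omega>) = {true_cluster_mat m K}}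
          \<ge> 1 - c * (real K * real m powr (- r) + real n powr (- r))
              - real n powr (- c\<^sub>1) - 2 * inverse (real m) * real n powr (- c\<^sub>2)"
proof -
  interpret prob_space M using assms(5) by (simp add: BM_bal_def)
  interpret block_model M A m K \<Psi> by unfold_locales fact
  define L where "L = ln (real n)"
  have "2 \<le> n" using mult_le_mono[OF assms(2,3)] assms(4) by simp
  then have L: "0 < L" by (simp add: L_def)
  have "0 \<in> {..<K}" using assms(3) by simp
  then have K: "{..<K} \<noteq> {}" "finite {..<K}" "dim_row \<Psi> = K" using psi_carrier by auto
  \<comment> \<open>K >= 2 makes the sets below \<open>q_star\<close> nonempty, which also gives the
    sign of these maxima.\<close>
  have other: "{..<K} - {k} \<noteq> {}" for k
  proof -
    have "(if k = 0 then 1 else 0) \<in> {..<K} - {k}" using assms(3) by auto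
    then show ?thesis by blast
  qed
  have q: "\<Psi> $$ (k, l) \<le> q_star \<Psi> k" if "k < K" "l < K" "k \<noteq> l" for k l
    unfolding q_star_def K(3) using that by (intro Max_ge) auto
  have q0: "0 \<le> q_star \<Psi> k" if "k < K" for k
  proof -
    obtain l where "l < K" "k \<noteq> l" using other[of k] by auto
    then show ?thesis using q[OF that, of l] psi_bounds(1)[OF that, of l] by linarith
  qed
  have qm: "q_star \<Psi> k \<le> q_star_max \<Psi>" if "k < K" for k
    unfolding q_star_max_def K(3) using that by (intro Max_ge) auto
  \<comment> \<open>The gap condition is multiplied by L; this rewrites its square roots in unscaled
    form.\<close>
  have sqrtL: "sqrt (z / L) * L = sqrt (z * L)" for z
    using L by (simp add: real_sqrt_mult real_sqrt_divide field_simps)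
  have sc: "scaled m n z = real m * z / L" for z by (simp add: scaled_def L_def mult.commute)
  have C1: "C' * L \<le> real m * \<Psi> $$ (k, k)" if "k < K" for k
  proof -
    have "C' \<le> scaled m n (p_in \<Psi> k)"
      using assms(9,11) that by (simp add: Min_ge_iff K)
    then show ?thesis using L by (simp add: sc p_in_def field_simps)
  qed
  have gap: "C * sqrt (real n * q_star_max \<Psi>) < real m * \<Psi> $$ (k, k) - real m * q_star \<Psi> k
      - C\<^sub>2 * (sqrt (real m * \<Psi> $$ (k, k) * L) + sqrt (real m * q_star \<Psi> k * L))" if "k < K" for k
  proof -
    let ?y = "real m * \<Psi> $$ (k, k)" and ?x = "real m * q_star \<Psi> k"
    \<comment> \<open>The scaled maximum times K / L is m K q / L^2 = n q / L^2, so multiplication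
      by L leaves sqrt (n q).\<close>
    have "C * sqrt (real n * q_star_max \<Psi> / (L * L)) < ?y / L - ?x / L - C\<^sub>2 * (sqrt (?y / L) + sqrt (?x / L))"
    proof -
      have "scaled m n (q_star_max \<Psi>) * real K / ln (real n) = real n * q_star_max \<Psi> / (L * L)"
        unfolding sc L_def[symmetric] by (simp add: assms(4))
      moreover have "C * sqrt (scaled m n (q_star_max \<Psi>) * real K / ln (real n)) <
          (scaled m n (p_in \<Psi> k) - scaled m n (q_star \<Psi> k))
            - C\<^sub>2 * (sqrt (scaled m n (p_in \<Psi> k)) + sqrt (scaled m n (q_star \<Psi> k)))"
        using assms(12) K(1) that by (subst (asm) Min_gr_iff) auto
      ultimately show ?thesis by (simp only: sc p_in_def)
    qed
    then have "C * sqrt (real n * q_star_max \<Psi> / (L * L)) * L <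
        (?y / L - ?x / L - C\<^sub>2 * (sqrt (?y / L) + sqrt (?x / L))) * L"
      using L by simp
    also have "\<dots> = ?y - ?x - C\<^sub>2 * (sqrt (?y / L) * L + sqrt (?x / L) * L)"
      using L by (simp add: algebra_simps)
    also have "C * sqrt (real n * q_star_max \<Psi> / (L * L)) * L = C * sqrt (real n * q_star_max \<Psi>)"
      using L by (simp add: real_sqrt_divide)
    finally show ?thesis unfolding sqrtL .
  qed
  show ?thesis
  \<comment> \<open>Instantiated with y k = m p_k and x k = m q*_k.\<close>
  proof (rule strong_consistency[OF assms(1-4) L_def assms(7,8) _ _ refl _ _ _ _ C1 gap])
    show "0 \<le> q_star_max \<Psi>" using q0[of 0] qm[of 0] assms(3) by simp
    show "\<Psi> $$ (k, l) \<le> q_star_max \<Psi>" if "k < K" "l < K" "k \<noteq> l" for k l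
      using q[OF that] qm[OF that(1)] by linarith
    show "real m * \<Psi> $$ (k, l) \<le> real m * q_star \<Psi> k" if "k < K" "l < K" "k \<noteq> l" for k l
      using q[OF that] by (simp add: mult_left_mono)
  qed (use assms(10) q0 in auto)
qed

end
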